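(* Let $\Sigma$ be a conjunction of functional dependencies $\Sigma_{\mathrm{FD}}$ and unary inclusion dependencies $\Sigma_{\mathrm{UID}}$ over a schema $\sigma$ which is closed under finite implication. For every finite instance $I_0$ of $\sigma$ with $I_0\models\Sigma_{\mathrm{FD}}$ and every $k\in\mathbb{N}$, there exists a finite superinstance $I$ of $I_0$ that satisfies $\Sigma$ and is $k$-sound for $\Sigma$ (and hence is $k$-universal).
   Context: Schema, instances and positions $R^p$ as usual; a superinstance of $I_0$ is any instance containing $I_0$. A unary inclusion dependency (UID) $R^p\subseteq S^q$ ($R^p\ne S^q$) is $\forall\mathbf{x}\,R(\mathbf{x})\to\exists\mathbf{y}\,S(\mathbf{z})$ with $z_q=x_p$ and the other $z_j$ distinct existential variables. A functional dependency (FD) $R^L\to R^r$ ($L$ a nonempty set of positions of $R$) states that any two $R$-facts that agree on the positions of $L$ agree on position $R^r$. $\Sigma$ is closed under finite implication if it contains every UID and FD over $\sigma$ that is satisfied by all finite instances satisfying $\Sigma$. For a Boolean conjunctive query (CQ) $q$, $(I_0,\Sigma)\models_{\mathrm{unr}} q$ means every (finite or infinite) superinstance of $I_0$ satisfying $\Sigma$ satisfies $q$. The size of a CQ is its number of atoms; a CQ is constant-free if it contains no constants. A superinstance $I$ of $I_0$ is $k$-sound for $\Sigma$ if for every constant-free CQ $q$ of size $\le k$ with $I\models q$ we have $(I_0,\Sigma)\models_{\mathrm{unr}} q$; it is $k$-universal if moreover $I\models q$ whenever $(I_0,\Sigma)\models_{\mathrm{unr}}q$ for such $q$. *)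

theory Defs
  imports Main
begin

record 'r schema =
  rels :: "'r set"
  arity :: "'r \<Rightarrow> nat"

definition wf_schema :: "'r schema \<Rightarrow> bool" where
  "wf_schema \<sigma> \<longleftrightarrow> finite (rels \<sigma>)"

text \<open>Positions of a relation are counted from 0, so that position \<open>p\<close> of a fact \<open>(R, xs)\<close>
  holds the element \<open>xs ! p\<close>.\<close>

type_synonym 'r position = "'r \<times> nat"

definition Pos :: "'r schema \<Rightarrow> 'r position set" where
  "Pos \<sigma> = {(R, p). R \<in> rels \<sigma> \<and> p < arity \<sigma> R}"

type_synonym ('r, 'a) fact = "'r \<times> 'a list"

definition is_instance :: "'r schema \<Rightarrow> ('r, 'a) fact set \<Rightarrow> bool" where
  "is_instance \<sigma> I \<longleftrightarrow> (\<forall>(R, xs) \<in> I. R \<in> rels \<sigma> \<and> length xs = arity \<sigma> R)"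

definition superinstance ::
  "'r schema \<Rightarrow> ('r, 'a) fact set \<Rightarrow> ('r, 'a) fact set \<Rightarrow> bool" where
  "superinstance \<sigma> I\<^sub>0 I \<longleftrightarrow> is_instance \<sigma> I \<and> I\<^sub>0 \<subseteq> I"

text \<open>\<open>UID (R, p) (S, q)\<close> is the inclusion of position \<open>p\<close> of \<open>R\<close> in position \<open>q\<close> of \<open>S\<close>;
  \<open>FD R L r\<close> says that the positions \<open>L\<close> of \<open>R\<close> determine its position \<open>r\<close>.\<close>

datatype 'r dependency =
    UID "'r position" "'r position"
  | FD 'r "nat set" nat

definition UIDs :: "'r schema \<Rightarrow> 'r dependency set" where
  "UIDs \<sigma> = {UID P Q | P Q. P \<in> Pos \<sigma> \<and> Q \<in> Pos \<sigma> \<and> P \<noteq> Q}"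

definition FDs :: "'r schema \<Rightarrow> 'r dependency set" where
  "FDs \<sigma> = {FD R L r | R L r.
     L \<noteq> {} \<and> (\<forall>l \<in> L. (R, l) \<in> Pos \<sigma>) \<and> (R, r) \<in> Pos \<sigma>}"

fun sat_dep :: "('r, 'a) fact set \<Rightarrow> 'r dependency \<Rightarrow> bool" where
  "sat_dep I (UID (R, p) (S, q)) \<longleftrightarrow>
     (\<forall>xs. (R, xs) \<in> I \<longrightarrow> (\<exists>zs. (S, zs) \<in> I \<and> zs ! q = xs ! p))"
| "sat_dep I (FD R L r) \<longleftrightarrow>
     (\<forall>xs ys. (R, xs) \<in> I \<longrightarrow> (R, ys) \<in> I \<longrightarrow> (\<forall>l \<in> L. xs ! l = ys ! l) \<longrightarrow> xs ! r = ys ! r)"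

definition satisfies :: "('r, 'a) fact set \<Rightarrow> 'r dependency set \<Rightarrow> bool" where
  "satisfies I \<Sigma> \<longleftrightarrow> (\<forall>d \<in> \<Sigma>. sat_dep I d)"

text \<open>The \<open>itself\<close> argument names the type of elements from which instances are built.\<close>

definition finitely_implies ::
  "'a itself \<Rightarrow> 'r schema \<Rightarrow> 'r dependency set \<Rightarrow> 'r dependency \<Rightarrow> bool" where
  "finitely_implies _ \<sigma> \<Sigma> d \<longleftrightarrow>
     (\<forall>I :: ('r, 'a) fact set. is_instance \<sigma> I \<and> finite I \<and> satisfies I \<Sigma> \<longrightarrow> sat_dep I d)"

definition closed_under_finite_implication ::
  "'a itself \<Rightarrow> 'r schema \<Rightarrow> 'r dependency set \<Rightarrow> bool" where
  "closed_under_finite_implication T \<sigma> \<Sigma> \<longleftrightarrow>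
     (\<forall>d \<in> UIDs \<sigma> \<union> FDs \<sigma>. finitely_implies T \<sigma> \<Sigma> d \<longrightarrow> d \<in> \<Sigma>)"

text \<open>A Boolean CQ is given by the list of its atoms, all variables being existentially
  quantified. Constants denote themselves.\<close>

datatype 'a cq_term = Var nat | Const 'a

type_synonym ('r, 'a) cq = "('r \<times> 'a cq_term list) list"

definition is_cq :: "'r schema \<Rightarrow> ('r, 'a) cq \<Rightarrow> bool" where
  "is_cq \<sigma> q \<longleftrightarrow> (\<forall>(R, ts) \<in> set q. R \<in> rels \<sigma> \<and> length ts = arity \<sigma> R)"

definition cq_size :: "('r, 'a) cq \<Rightarrow> nat" where
  "cq_size q = length q"

definition constant_free :: "('r, 'a) cq \<Rightarrow> bool" where
  "constant_free q \<longleftrightarrow> (\<forall>(R, ts) \<in> set q. \<forall>c. Const c \<notin> set ts)"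

fun eval_term :: "(nat \<Rightarrow> 'a) \<Rightarrow> 'a cq_term \<Rightarrow> 'a" where
  "eval_term \<nu> (Var v) = \<nu> v"
| "eval_term \<nu> (Const c) = c"

definition sat_cq :: "('r, 'a) fact set \<Rightarrow> ('r, 'a) cq \<Rightarrow> bool" where
  "sat_cq I q \<longleftrightarrow> (\<exists>\<nu>. \<forall>(R, ts) \<in> set q. (R, map (eval_term \<nu>) ts) \<in> I)"

definition entails_unr ::
  "'r schema \<Rightarrow> ('r, 'a) fact set \<Rightarrow> 'r dependency set \<Rightarrow> ('r, 'a) cq \<Rightarrow> bool" where
  "entails_unr \<sigma> I\<^sub>0 \<Sigma> q \<longleftrightarrow>
     (\<forall>I. superinstance \<sigma> I\<^sub>0 I \<and> satisfies I \<Sigma> \<longrightarrow> sat_cq I q)"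

definition k_sound ::
  "'r schema \<Rightarrow> nat \<Rightarrow> 'r dependency set \<Rightarrow> ('r, 'a) fact set \<Rightarrow> ('r, 'a) fact set \<Rightarrow> bool" where
  "k_sound \<sigma> k \<Sigma> I\<^sub>0 I \<longleftrightarrow>
     (\<forall>q. is_cq \<sigma> q \<and> constant_free q \<and> cq_size q \<le> k \<and> sat_cq I q \<longrightarrow> entails_unr \<sigma> I\<^sub>0 \<Sigma> q)"

definition k_universal ::
  "'r schema \<Rightarrow> nat \<Rightarrow> 'r dependency set \<Rightarrow> ('r, 'a) fact set \<Rightarrow> ('r, 'a) fact set \<Rightarrow> bool" where
  "k_universal \<sigma> k \<Sigma> I\<^sub>0 I \<longleftrightarrow> k_sound \<sigma> k \<Sigma> I\<^sub>0 I \<and>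
     (\<forall>q. is_cq \<sigma> q \<and> constant_free q \<and> cq_size q \<le> k \<and> entails_unr \<sigma> I\<^sub>0 \<Sigma> q \<longrightarrow> sat_cq I q)"

end

theory Submission
  imports Defs "HOL-Combinatorics.Permutations" "HOL-Library.FuncSet"
begin

text \<open>
  The universal model is the chase by the UIDs: an element that lacks a required fact receives
  one whose other elements are fresh, and no FD is ever violated. We close the chase up finitely so
  that every small part of the result still maps into every model.

  In finite models a UID \<open>P \<subseteq> Q\<close> and a unary FD from \<open>Q\<close> to \<open>P\<close> both say that \<open>P\<close> has at most as many
  values as \<open>Q\<close>. Closure under finite implication makes every dependency on a cycle of such
  inequalities reversible. Hence a branch of the chase either stays, from some point on, among
  reversible dependencies, or it creates an element at a position that does not determine the
  position for which the fact was created. In the first case, steps can be retraced in every model,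
  so after \<open>K\<close> of them the past of an element does not matter, and missing facts can be built from
  elements that are already there; a counting argument shows that equally many elements are
  missing at equivalent positions. In the second case the element may be shared by all
  facts that have the same recent history. To respect the FDs each such fact owns a vector, and
  a shared element depends on those coordinates \<open>a\<close> only for which its position is not determined by
  the position \<open>a\<close>. If two facts agree on positions that determine one outside the shared ones, then
  all their coordinates agree.

  Finally the elements are multiplied with the permutations of a set of reduced words. This removes short
  cycles, so that small connected parts are seen as parts of a tree, along which a
  homomorphism is built step by step, given that the recent histories match.
\<close>

section \<open>Closure under finite implication\<close>

text \<open>The obstacle is that finiteness forces old elements into new facts, while an FD forbids
  two facts to share determining elements and to differ elsewhere. Inside a unit the answer is
  radical: apart from initial facts, no two facts of one relation have the same element at the same
  position, so FDs of any shape hold there for want of agreeing facts. Hence only unary FDs enter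
  the counting. FDs with larger left sides matter only where elements are shared between units, and
  the vectors are made for them.

  Histories and permutations guard against different dangers. A history tells how far back an
  element can be traced in an arbitrary model; the permutations make small parts of the instance
  fold onto a tree. They draw on one budget: each letter of a word costs one remembered event. In a
  connected part of at most \<open>k\<close> facts, any two are joined by at most
  \<open>k * k\<close> steps (a crude bound), and a step moves the word by at most two letters; this
  is the origin of \<open>K = 2 * (k * k) + 1\<close>.\<close>

definition proj :: "('r, 'a) fact set \<Rightarrow> 'r position \<Rightarrow> 'a set" where
  "proj I P = {xs ! snd P | xs. (fst P, xs) \<in> I}"

lemma projI: "(R, xs) \<in> I \<Longrightarrow> xs ! p \<in> proj I (R, p)"
  by (auto simp: proj_def)

lemma projE:
  assumes "y \<in> proj I (R, p)"
  obtains xs where "(R, xs) \<in> I" "xs ! p = y"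
  using assms by (auto simp: proj_def)

lemma finite_proj: "finite I \<Longrightarrow> finite (proj I P)"
proof -
  assume "finite I"
  moreover have "proj I P \<subseteq> (\<lambda>f. snd f ! snd P) ` I"
    by (force simp: proj_def)
  ultimately show ?thesis
    by (meson finite_imageI finite_subset)
qed

lemma sat_UID_iff: "sat_dep I (UID P Q) \<longleftrightarrow> proj I P \<subseteq> proj I Q"
proof (cases P, cases Q)
  fix R p S q
  assume PQ: "P = (R, p)" "Q = (S, q)"
  have "proj I (R, p) \<subseteq> proj I (S, q) \<longleftrightarrow> (\<forall>xs. (R, xs) \<in> I \<longrightarrow> xs ! p \<in> proj I (S, q))"
    by (auto intro: projI elim: projE)
  also have "\<dots> \<longleftrightarrow> sat_dep I (UID P Q)"
    unfolding PQ sat_dep.simps by (metis projE projI)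
  finally show ?thesis using PQ by simp
qed

lemma finite_Pos: "wf_schema \<sigma> \<Longrightarrow> finite (Pos \<sigma>)"
proof -
  assume "wf_schema \<sigma>"
  moreover have "Pos \<sigma> = (SIGMA R : rels \<sigma>. {..<arity \<sigma> R})"
    by (auto simp: Pos_def)
  ultimately show ?thesis by (simp add: wf_schema_def)
qed

lemma surj_card_eq_imp_inj:
  assumes "finite A" "f ` A = B" "card A \<le> card B"
  shows "inj_on f A"
  using assms by (metis card_image_le eq_card_imp_inj_on le_antisym)

text \<open>\<open>K\<close> bounds the history that is remembered about an element.\<close>

locale fin_closed =
  fixes \<sigma> :: "'r schema" and \<Sigma> :: "'r dependency set"
    and I\<^sub>0 :: "('r, 'a) fact set" and K :: nat
  assumes wf: "wf_schema \<sigma>"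
    and sub: "\<Sigma> \<subseteq> UIDs \<sigma> \<union> FDs \<sigma>"
    and closed: "closed_under_finite_implication TYPE('a) \<sigma> \<Sigma>"
    and inst: "is_instance \<sigma> I\<^sub>0"
    and fin_I\<^sub>0: "finite I\<^sub>0"
    and sat_I\<^sub>0: "FD R L r \<in> \<Sigma> \<Longrightarrow> sat_dep I\<^sub>0 (FD R L r)"
    and K_pos: "K > 0"
begin

text \<open>Closure is used only in this semantic form: each dependency below is put into
  \<open>\<Sigma>\<close> by verifying it in every finite model, not by a system of inference
  rules.\<close>

lemma impliedI:
  assumes "d \<in> UIDs \<sigma> \<union> FDs \<sigma>"
    and "\<And>I :: ('r, 'a) fact set. is_instance \<sigma> I \<Longrightarrow> finite I \<Longrightarrow> satisfies I \<Sigma> \<Longrightarrow> sat_dep I d"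
  shows "d \<in> \<Sigma>"
  using closed assms unfolding closed_under_finite_implication_def finitely_implies_def by blast

text \<open>Made reflexive because \<open>UIDs\<close> excludes \<open>P = Q\<close>; otherwise
  \<open>cls P\<close> would not contain \<open>P\<close>.\<close>

definition uid :: "'r position \<Rightarrow> 'r position \<Rightarrow> bool" where
  "uid P Q \<longleftrightarrow> P \<in> Pos \<sigma> \<and> (P = Q \<or> UID P Q \<in> \<Sigma>)"

definition ufd :: "'r \<Rightarrow> nat \<Rightarrow> nat \<Rightarrow> bool" where
  "ufd R i j \<longleftrightarrow> FD R {i} j \<in> \<Sigma>"

lemma UID_D: "UID P Q \<in> \<Sigma> \<Longrightarrow> P \<in> Pos \<sigma> \<and> Q \<in> Pos \<sigma> \<and> P \<noteq> Q"
  using sub by (auto simp: UIDs_def FDs_def)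

lemma FD_D: "FD R L r \<in> \<Sigma> \<Longrightarrow> L \<noteq> {} \<and> (\<forall>l \<in> L. (R, l) \<in> Pos \<sigma>) \<and> (R, r) \<in> Pos \<sigma>"
  using sub by (auto simp: UIDs_def FDs_def)

lemma uid_Pos: "uid P Q \<Longrightarrow> P \<in> Pos \<sigma> \<and> Q \<in> Pos \<sigma>"
  using UID_D unfolding uid_def by blast

lemma uid_refl [simp]: "P \<in> Pos \<sigma> \<Longrightarrow> uid P P"
  by (simp add: uid_def)

lemma uid_proj: "uid P Q \<Longrightarrow> satisfies I \<Sigma> \<Longrightarrow> proj I P \<subseteq> proj I Q"
  using sat_UID_iff[of I P Q] by (auto simp: uid_def satisfies_def simp del: sat_dep.simps)

lemma uidI:
  assumes "P \<in> Pos \<sigma>" "Q \<in> Pos \<sigma>"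
    and "\<And>I :: ('r, 'a) fact set. is_instance \<sigma> I \<Longrightarrow> finite I \<Longrightarrow> satisfies I \<Sigma> \<Longrightarrow> proj I P \<subseteq> proj I Q"
  shows "uid P Q"
proof (cases "P = Q")
  case False
  then have "UID P Q \<in> UIDs \<sigma> \<union> FDs \<sigma>"
    using assms(1,2) unfolding UIDs_def by blast
  then have "UID P Q \<in> \<Sigma>"
    by (rule impliedI) (simp only: sat_UID_iff assms(3))
  then show ?thesis using assms by (simp add: uid_def)
qed (use assms in simp)

lemma uid_trans: "uid P Q \<Longrightarrow> uid Q S \<Longrightarrow> uid P S"
proof (rule uidI)
  assume a: "uid P Q" "uid Q S"
  then show "P \<in> Pos \<sigma>" "S \<in> Pos \<sigma>" using uid_Pos by auto
  show "proj I P \<subseteq> proj I S" if "satisfies I \<Sigma>" for I :: "('r, 'a) fact set"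
    using uid_proj[OF a(1) that] uid_proj[OF a(2) that] by (rule subset_trans)
qed

lemma fdI:
  assumes "L \<noteq> {}" "\<forall>l \<in> L. (R, l) \<in> Pos \<sigma>" "(R, r) \<in> Pos \<sigma>"
    and "\<And>I :: ('r, 'a) fact set. is_instance \<sigma> I \<Longrightarrow> finite I \<Longrightarrow> satisfies I \<Sigma> \<Longrightarrow> sat_dep I (FD R L r)"
  shows "FD R L r \<in> \<Sigma>"
proof (rule impliedI)
  show "FD R L r \<in> UIDs \<sigma> \<union> FDs \<sigma>" using assms(1-3) by (simp add: FDs_def)
qed (rule assms(4))

lemma fd_trans:
  assumes "FD R L r \<in> \<Sigma>" "\<And>l. l \<in> L \<Longrightarrow> ufd R j l"
  shows "ufd R j r"
  unfolding ufd_def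
proof (rule fdI)
  obtain l where "l \<in> L" using FD_D[OF assms(1)] by auto
  then show "\<forall>l \<in> {j}. (R, l) \<in> Pos \<sigma>" using FD_D[OF assms(2)[unfolded ufd_def]] by blast
  show "(R, r) \<in> Pos \<sigma>" using FD_D[OF assms(1)] by auto
  fix I :: "('r, 'a) fact set"
  assume I: "satisfies I \<Sigma>"
  then have "sat_dep I (FD R L r)"
    using assms(1) unfolding satisfies_def by blast
  moreover have "sat_dep I (FD R {j} l)" if "l \<in> L" for l
    using assms(2)[OF that] I unfolding satisfies_def ufd_def by blast
  ultimately show "sat_dep I (FD R {j} r)" unfolding sat_dep.simps by blast
qed simp

lemma ufd_Pos: "ufd R i j \<Longrightarrow> (R, i) \<in> Pos \<sigma> \<and> (R, j) \<in> Pos \<sigma>"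
  using FD_D[of R "{i}" j] by (simp add: ufd_def)

lemma ufd_refl [simp]: "(R, i) \<in> Pos \<sigma> \<Longrightarrow> ufd R i i"
  unfolding ufd_def by (rule fdI) auto

lemma ufd_trans: "ufd R i j \<Longrightarrow> ufd R j l \<Longrightarrow> ufd R i l"
  using fd_trans[of R "{j}" l i] unfolding ufd_def by simp

section \<open>The cardinality preorder on positions\<close>

definition dominated :: "('r position \<times> 'r position) set" where
  "dominated = {(P, Q). UID P Q \<in> \<Sigma>} \<union> {((R, p), (R, i)) | R p i. ufd R i p}"

text \<open>The size of the down-set of \<open>P\<close> in the preorder generated by
  \<open>dominated\<close>. It never decreases along the preorder, and comparable positions of equal
  rank lie on a common cycle.\<close>

definition rank :: "'r position \<Rightarrow> nat" where
  "rank P = card {Q \<in> Pos \<sigma>. (Q, P) \<in> dominated\<^sup>*}"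

lemma ufd_proj_image:
  assumes "ufd R i p" "satisfies I \<Sigma>"
  obtains f where "\<And>xs. (R, xs) \<in> I \<Longrightarrow> f (xs ! i) = xs ! p" "f ` proj I (R, i) = proj I (R, p)"
proof -
  define f where "f = (\<lambda>x. SOME y. \<exists>xs. (R, xs) \<in> I \<and> xs ! i = x \<and> xs ! p = y)"
  have fd: "sat_dep I (FD R {i} p)"
    using assms unfolding satisfies_def ufd_def by blast
  have f: "f (xs ! i) = xs ! p" if "(R, xs) \<in> I" for xs
    unfolding f_def
  proof (rule some_equality)
    show "\<exists>ys. (R, ys) \<in> I \<and> ys ! i = xs ! i \<and> ys ! p = xs ! p" using that by blast
    show "y = xs ! p" if "\<exists>ys. (R, ys) \<in> I \<and> ys ! i = xs ! i \<and> ys ! p = y" for y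
      using that \<open>(R, xs) \<in> I\<close> fd unfolding sat_dep.simps by blast
  qed
  moreover have "f ` proj I (R, i) = proj I (R, p)"
  proof (intro equalityI subsetI)
    fix y assume "y \<in> f ` proj I (R, i)"
    then obtain x where x: "x \<in> proj I (R, i)" "y = f x" by (rule imageE)
    then obtain xs where xs: "(R, xs) \<in> I" "xs ! i = x" by (elim projE)
    then have "y = xs ! p" using f[OF xs(1)] xs(2) x(2) by simp
    then show "y \<in> proj I (R, p)" using projI[OF xs(1)] by simp
  next
    fix y assume "y \<in> proj I (R, p)"
    then obtain xs where xs: "(R, xs) \<in> I" "xs ! p = y" by (rule projE)
    then have "y = f (xs ! i)" using f[OF xs(1)] by simp
    then show "y \<in> f ` proj I (R, i)" using projI[OF xs(1)] by (rule image_eqI)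
  qed
  ultimately show ?thesis by (rule that)
qed

lemma dominated_card:
  assumes "(P, Q) \<in> dominated\<^sup>*" "finite I" "satisfies I \<Sigma>"
  shows "card (proj I P) \<le> card (proj I Q)"
  using assms(1)
proof (induction rule: rtrancl_induct)
  case (step Q S)
  have "card (proj I Q) \<le> card (proj I S)"
    using step(2) unfolding dominated_def
  proof
    assume "(Q, S) \<in> {(P, Q). UID P Q \<in> \<Sigma>}"
    then have "uid Q S" using UID_D[of Q S] by (simp add: uid_def)
    then show ?thesis using uid_proj assms(2,3) finite_proj by (intro card_mono) blast+
  next
    assume "(Q, S) \<in> {((R, p), R, i) |R p i. ufd R i p}"
    then obtain R p i where "Q = (R, p)" "S = (R, i)" "ufd R i p" by blast
    then obtain f where "f ` proj I S = proj I Q"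
      using ufd_proj_image[of R i p I] assms(3) by blast
    then show ?thesis using assms(2) finite_proj card_image_le by metis
  qed
  then show ?case using step by simp
qed simp

lemma rank_mono: "(P, Q) \<in> dominated\<^sup>* \<Longrightarrow> rank P \<le> rank Q"
  unfolding rank_def
  by (rule card_mono) (use finite_Pos[OF wf] in auto)

lemma rank_eq:
  assumes "(P, Q) \<in> dominated\<^sup>*" "rank P = rank Q" "Q \<in> Pos \<sigma>"
  shows "(Q, P) \<in> dominated\<^sup>*"
proof -
  have "{S \<in> Pos \<sigma>. (S, P) \<in> dominated\<^sup>*} = {S \<in> Pos \<sigma>. (S, Q) \<in> dominated\<^sup>*}"
    using assms(1,2) unfolding rank_def by (intro card_subset_eq) (use finite_Pos[OF wf] in auto)
  then show ?thesis using assms(3) by auto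
qed

lemma uid_dominated: "uid P Q \<Longrightarrow> (P, Q) \<in> dominated\<^sup>*"
  by (auto simp: uid_def dominated_def)

lemma ufd_dominated: "ufd R i p \<Longrightarrow> ((R, p), (R, i)) \<in> dominated\<^sup>*"
  by (auto simp: dominated_def)

lemmas uid_rank = uid_dominated[THEN rank_mono] and ufd_rank = ufd_dominated[THEN rank_mono]

text \<open>Equal ranks give a path of inequalities back from \<open>Q\<close> to \<open>P\<close>,
  and a subset of a finite set that is no smaller than it is the whole set.\<close>

lemma uid_reversible:
  assumes "uid P Q" "rank P = rank Q"
  shows "uid Q P"
proof (rule uidI)
  show "Q \<in> Pos \<sigma>" "P \<in> Pos \<sigma>" using uid_Pos assms(1) by auto
  fix I :: "('r, 'a) fact set"
  assume I: "finite I" "satisfies I \<Sigma>"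
  have "(Q, P) \<in> dominated\<^sup>*" using rank_eq[OF uid_dominated[OF assms(1)] assms(2)] uid_Pos[OF assms(1)] by blast
  then have "card (proj I Q) \<le> card (proj I P)" by (rule dominated_card[OF _ I])
  then show "proj I Q \<subseteq> proj I P"
    using uid_proj[OF assms(1) I(2)] finite_proj[OF I(1)] by (metis card_seteq)
qed

text \<open>On a cycle, the surjection given by the FD goes between finite sets of equal size, so it
  is a bijection, and its inverse is the reversed FD.\<close>

lemma ufd_reversible:
  assumes "ufd R i p" "rank (R, p) = rank (R, i)"
  shows "ufd R p i"
  unfolding ufd_def
proof (rule fdI)
  show "\<forall>l \<in> {p}. (R, l) \<in> Pos \<sigma>" "(R, i) \<in> Pos \<sigma>" using assms(1) ufd_Pos by auto
  fix I :: "('r, 'a) fact set"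
  assume I: "finite I" "satisfies I \<Sigma>"
  obtain f where f: "\<And>xs. (R, xs) \<in> I \<Longrightarrow> f (xs ! i) = xs ! p" "f ` proj I (R, i) = proj I (R, p)"
    using ufd_proj_image[OF assms(1) I(2)] by blast
  have "((R, i), (R, p)) \<in> dominated\<^sup>*" using rank_eq[OF ufd_dominated[OF assms(1)] assms(2)] ufd_Pos[OF assms(1)] by blast
  then have "card (proj I (R, i)) \<le> card (proj I (R, p))" by (rule dominated_card[OF _ I])
  then have inj: "inj_on f (proj I (R, i))"
    using surj_card_eq_imp_inj[OF finite_proj[OF I(1)] f(2)] by blast
  show "sat_dep I (FD R {p} i)"
    unfolding sat_dep.simps
  proof (intro allI impI)
    fix xs ys
    assume a: "(R, xs) \<in> I" "(R, ys) \<in> I" "\<forall>l\<in>{p}. xs ! l = ys ! l"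
    then have "f (xs ! i) = f (ys ! i)" using f(1)[OF a(1)] f(1)[OF a(2)] by simp
    then show "xs ! i = ys ! i" by (rule inj_onD[OF inj _ projI[OF a(1)] projI[OF a(2)]])
  qed
qed simp

end

section \<open>Histories\<close>

text \<open>The state of an element records how it is reached, latest event first: \<open>EInit a\<close> is the
  element \<open>a\<close> of the initial instance, \<open>EStep R p j\<close> is the creation at position \<open>j\<close> of an
  \<open>R\<close>-fact that was required by the element at position \<open>p\<close>, and \<open>EZ c\<close> stands for an element
  of the \<open>UID\<close>-class \<open>c\<close> whose history has been forgotten. A fact of type \<open>Cr s R p\<close> was required by an
  element of state \<open>s\<close> at position \<open>p\<close>.\<close>

datatype ('r, 'a) event = EInit 'a | EZ "'r position set" | EStep 'r nat nat

datatype ('r, 'a) ftype = Init 'r "'a list" | Cr "('r, 'a) event list" 'r nat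

fun rel :: "('r, 'a) ftype \<Rightarrow> 'r" where
  "rel (Init R xs) = R"
| "rel (Cr s R p) = R"

text \<open>The element \<open>y\<close> of \<open>J\<close> can play the role of an element of state \<open>s\<close> as far as the last \<open>n\<close> events
  are concerned.\<close>

fun hom_at :: "('r, 'a) fact set \<Rightarrow> nat \<Rightarrow> ('r, 'a) event list \<Rightarrow> 'a \<Rightarrow> bool" where
  "hom_at J 0 s y \<longleftrightarrow> True"
| "hom_at J (Suc n) [] y \<longleftrightarrow> True"
| "hom_at J (Suc n) (EInit a # s) y \<longleftrightarrow> y = a"
| "hom_at J (Suc n) (EZ c # s) y \<longleftrightarrow> (\<exists>P \<in> c. y \<in> proj J P)"
| "hom_at J (Suc n) (EStep R p j # s) y \<longleftrightarrow> (\<exists>ys. (R, ys) \<in> J \<and> ys ! j = y \<and> hom_at J n s (ys ! p))"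

lemma hom_at_take: "n \<le> m \<Longrightarrow> hom_at J n (take m s) y = hom_at J n s y"
proof (induction n arbitrary: m s y)
  case (Suc n)
  then obtain m' where m: "m = Suc m'" "n \<le> m'" by (cases m) auto
  show ?case
  proof (cases s)
    case (Cons e t)
    then show ?thesis using Suc.IH[OF m(2)] m(1) by (cases e) simp_all
  qed simp
qed simp

lemma hom_at_Suc: "hom_at J (Suc n) s y \<Longrightarrow> hom_at J n s y"
proof (induction n arbitrary: s y)
  case (Suc n)
  show ?case
  proof (cases s)
    case (Cons e t)
    show ?thesis
    proof (cases e)
      case (EStep R p j)
      then obtain ys where ys: "(R, ys) \<in> J" "ys ! j = y" "hom_at J (Suc n) t (ys ! p)"
        using Suc.prems Cons by auto
      then show ?thesis using Suc.IH[OF ys(3)] Cons EStep by auto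
    qed (use Suc.prems Cons in simp_all)
  qed simp
qed simp

lemma hom_at_mono: "hom_at J m s y \<Longrightarrow> n \<le> m \<Longrightarrow> hom_at J n s y"
proof (induction m)
  case (Suc m)
  then show ?case using hom_at_Suc[of J m s y] by (cases "n = Suc m") auto
qed simp

context fin_closed
begin

section \<open>States of elements and types of facts\<close>

definition eqv :: "'r \<Rightarrow> nat \<Rightarrow> nat \<Rightarrow> bool" where
  "eqv R i j \<longleftrightarrow> ufd R i j \<and> ufd R j i"

definition cls :: "'r position \<Rightarrow> 'r position set" where
  "cls P = {Q. uid P Q \<and> uid Q P}"

text \<open>The element created last can pass from its position to \<open>P\<close> and back by
  UIDs. In a run such passages alternate with steps inside a fact between equivalent
  positions.\<close>

fun linked :: "'r position \<Rightarrow> ('r, 'a) event list \<Rightarrow> bool" where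
  "linked P (EStep R p j # s) \<longleftrightarrow> (R, j) \<in> cls P"
| "linked P s \<longleftrightarrow> False"

text \<open>The length of the last sequence of reversible steps. Such steps can be retraced in every model
  (lemma \<open>hom_at_run\<close>), hence the history may be forgotten after \<open>K\<close> of them.\<close>

fun run :: "('r, 'a) event list \<Rightarrow> nat" where
  "run (EStep R p j # s) = (if eqv R j p then Suc (if linked (R, p) s then run s else 0) else 0)"
| "run s = 0"

text \<open>The first disjunct keeps a forgotten history forgotten along reversible steps. A fact
  required by an element of state \<open>[EZ c]\<close> then expects elements with forgotten
  histories at all positions equivalent to \<open>p\<close>, and these are what
  \<open>closing_step\<close> reuses.\<close>

definition forget :: "('r, 'a) event list \<Rightarrow> 'r \<Rightarrow> nat \<Rightarrow> nat \<Rightarrow> bool" where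
  "forget s R p j \<longleftrightarrow> (\<exists>c. s = [EZ c] \<and> (R, p) \<in> c \<and> eqv R j p) \<or> K \<le> run (EStep R p j # s)"

definition nxt :: "('r, 'a) event list \<Rightarrow> 'r \<Rightarrow> nat \<Rightarrow> nat \<Rightarrow> ('r, 'a) event list" where
  "nxt s R p j = (if forget s R p j then [EZ (cls (R, j))] else take K (EStep R p j # s))"

definition model :: "('r, 'a) fact set \<Rightarrow> bool" where
  "model J \<longleftrightarrow> superinstance \<sigma> I\<^sub>0 J \<and> satisfies J \<Sigma>"

text \<open>An element with a forgotten history carries no facts that would lead to its image in a
  model; it has one because its relation is nonempty in every model.\<close>

definition reach :: "'r \<Rightarrow> bool" where
  "reach R \<longleftrightarrow> (\<forall>J. model J \<longrightarrow> (\<exists>xs. (R, xs) \<in> J))"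

text \<open>The positions at which an element of state \<open>s\<close> has to occur. Only the
  latest event counts: the positions that it guarantees are closed upwards under UIDs.\<close>

fun up :: "('r, 'a) event list \<Rightarrow> 'r position set" where
  "up [] = {}"
| "up (EInit a # s) = {Q. \<exists>P. a \<in> proj I\<^sub>0 P \<and> uid P Q}"
| "up (EZ c # s) = {Q. \<exists>P \<in> c. uid P Q}"
| "up (EStep R p j # s) = {Q. uid (R, j) Q}"

inductive okst :: "('r, 'a) event list \<Rightarrow> bool" where
  okst_Init: "(R, xs) \<in> I\<^sub>0 \<Longrightarrow> a \<in> set xs \<Longrightarrow> okst [EInit a]"
| okst_Z: "P \<in> Pos \<sigma> \<Longrightarrow> reach (fst P) \<Longrightarrow> okst [EZ (cls P)]"
| okst_nxt: "okst s \<Longrightarrow> (R, p) \<in> up s \<Longrightarrow> j < arity \<sigma> R \<Longrightarrow> j \<noteq> p \<Longrightarrow> okst (nxt s R p j)"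

fun okft :: "('r, 'a) ftype \<Rightarrow> bool" where
  "okft (Init R xs) \<longleftrightarrow> (R, xs) \<in> I\<^sub>0"
| "okft (Cr s R p) \<longleftrightarrow> okst s \<and> (R, p) \<in> up s"

fun ty :: "('r, 'a) ftype \<Rightarrow> nat \<Rightarrow> ('r, 'a) event list" where
  "ty (Init R xs) i = [EInit (xs ! i)]"
| "ty (Cr s R p) i = (if i = p then s else nxt s R p i)"

abbreviation ar :: "('r, 'a) ftype \<Rightarrow> nat" where
  "ar \<gamma> \<equiv> arity \<sigma> (rel \<gamma>)"

lemma cls_refl [simp]: "P \<in> Pos \<sigma> \<Longrightarrow> P \<in> cls P"
  by (simp add: cls_def)

lemma cls_Pos: "cls P \<subseteq> Pos \<sigma>"
proof
  show "Q \<in> Pos \<sigma>" if "Q \<in> cls P" for Q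
    using that uid_Pos[of P Q] by (simp add: cls_def)
qed

lemma cls_eq: "Q \<in> cls P \<Longrightarrow> cls Q = cls P"
  unfolding cls_def using uid_trans by blast

lemma eqv_sym: "eqv R i j \<Longrightarrow> eqv R j i"
  by (simp add: eqv_def)

lemma eqv_trans: "eqv R i j \<Longrightarrow> eqv R j l \<Longrightarrow> eqv R i l"
  unfolding eqv_def using ufd_trans by blast

lemma eqv_refl [simp]: "(R, i) \<in> Pos \<sigma> \<Longrightarrow> eqv R i i"
  by (simp add: eqv_def)

lemma linked_take: "linked P (take n s) \<longleftrightarrow> 0 < n \<and> linked P s"
  by (cases n; cases "(P, s)" rule: linked.cases) auto

lemma run_take: "run (take n s) = min n (run s)"
proof (induction s arbitrary: n)
  case (Cons e s)
  show ?case
  proof (cases n)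
    case (Suc m)
    show ?thesis
    proof (cases e)
      case (EStep R p j)
      then show ?thesis using Suc Cons.IH[of m] linked_take[of "(R, p)" m s] by auto
    qed (use Suc in auto)
  qed simp
qed simp

lemma up_closed: "Q \<in> up s \<Longrightarrow> uid Q Q' \<Longrightarrow> Q' \<in> up s"
proof (cases s rule: up.cases)
  case (4 R p j t)
  then show "Q \<in> up s \<Longrightarrow> uid Q Q' \<Longrightarrow> ?thesis" using uid_trans[of "(R, j)" Q Q'] by simp
qed (use uid_trans[of _ Q Q'] in auto)

lemma up_Pos: "Q \<in> up s \<Longrightarrow> Q \<in> Pos \<sigma>"
  using uid_Pos[of _ Q] by (cases s rule: up.cases) auto

lemma up_take: "0 < n \<Longrightarrow> up (take n s) = up s"
  by (cases n; cases s rule: up.cases) auto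

lemma up_cls: "P \<in> Pos \<sigma> \<Longrightarrow> up [EZ (cls P)] = {Q. uid P Q}"
proof -
  assume P: "P \<in> Pos \<sigma>"
  then have "P \<in> cls P" by simp
  moreover have "uid P Q" if "S \<in> cls P" "uid S Q" for S Q
    using that uid_trans[of P S Q] by (simp add: cls_def)
  ultimately show ?thesis by auto
qed

lemma up_nxt: "(R, j) \<in> Pos \<sigma> \<Longrightarrow> up (nxt s R p j) = {Q. uid (R, j) Q}"
  using up_cls up_take[OF K_pos] by (simp add: nxt_def del: take_Suc_Cons)

lemma Pos_iff: "(R, i) \<in> Pos \<sigma> \<longleftrightarrow> R \<in> rels \<sigma> \<and> i < arity \<sigma> R"
  by (simp add: Pos_def)

lemma Pos_other: "(R, p) \<in> Pos \<sigma> \<Longrightarrow> j < arity \<sigma> R \<Longrightarrow> (R, j) \<in> Pos \<sigma>"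
  by (simp add: Pos_def)

lemma model_inst: "model J \<Longrightarrow> (R, xs) \<in> J \<Longrightarrow> R \<in> rels \<sigma> \<and> length xs = arity \<sigma> R"
  by (auto simp: model_def superinstance_def is_instance_def)

lemma model_sub: "model J \<Longrightarrow> I\<^sub>0 \<subseteq> J"
  by (simp add: model_def superinstance_def)

lemma model_uid: "model J \<Longrightarrow> uid P Q \<Longrightarrow> y \<in> proj J P \<Longrightarrow> y \<in> proj J Q"
  using uid_proj[of P Q J] unfolding model_def by blast

lemma reach_uid: "reach R \<Longrightarrow> uid (R, p) (S, q) \<Longrightarrow> reach S"
  unfolding reach_def
proof (intro allI impI)
  fix J assume "\<forall>J. model J \<longrightarrow> (\<exists>xs. (R, xs) \<in> J)" and uid: "uid (R, p) (S, q)" and J: "model J"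
  then obtain xs where "(R, xs) \<in> J" by blast
  then have "xs ! p \<in> proj J (S, q)" using model_uid[OF J uid] projI by metis
  then show "\<exists>xs. (S, xs) \<in> J" by (elim projE) blast
qed

text \<open>Truncation to \<open>K\<close> events does not shorten a run here, since a run of length
  \<open>K\<close> or more would have been forgotten.\<close>

lemma run_nxt: "run (nxt s R p j) = (if forget s R p j then 0 else run (EStep R p j # s))"
  unfolding nxt_def forget_def by (auto simp: run_take simp del: take_Suc_Cons)

lemma okst_run: "okst s \<Longrightarrow> run s < K"
  by (induction rule: okst.induct) (use K_pos in \<open>auto simp: run_nxt forget_def simp del: run.simps(1)\<close>)

lemma okst_reach: "okst s \<Longrightarrow> (S, q) \<in> up s \<Longrightarrow> reach S"
proof (induction arbitrary: S q rule: okst.induct)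
  case (okst_Init R xs a)
  then obtain T t where T: "a \<in> proj I\<^sub>0 (T, t)" "uid (T, t) (S, q)" by auto
  then obtain ys where "(T, ys) \<in> I\<^sub>0" by (elim projE)
  then have "reach T" unfolding reach_def using model_sub by blast
  then show ?case using T(2) reach_uid by blast
next
  case (okst_Z P)
  then have "uid (fst P, snd P) (S, q)" using okst_Z.prems unfolding up_cls[OF okst_Z.hyps(1)] by simp
  then show ?case using okst_Z.hyps(2) reach_uid by blast
next
  case (okst_nxt s R p j)
  then have "(R, j) \<in> Pos \<sigma>" using up_Pos Pos_other by blast
  then have "uid (R, j) (S, q)" using okst_nxt.prems up_nxt by simp
  then show ?case using okst_nxt reach_uid by blast
qed

lemma okst_Z_form: "okst (EZ c # t) \<Longrightarrow> t = [] \<and> (\<exists>P \<in> Pos \<sigma>. c = cls P)"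
proof (induction "EZ c # t" rule: okst.induct)
  case (okst_nxt s R p j)
  have "(R, j) \<in> Pos \<sigma>" using up_Pos Pos_other okst_nxt.hyps by blast
  moreover have "forget s R p j"
    using okst_nxt.hyps(6) K_pos by (auto simp: nxt_def take_Cons' split: if_splits)
  ultimately show ?case using okst_nxt.hyps(6) by (auto simp: nxt_def)
qed auto

lemma okst_Z_cls: "okst [EZ c] \<Longrightarrow> Q \<in> c \<Longrightarrow> c = cls Q"
  using okst_Z_form[of c "[]"] cls_eq by metis

lemma okft_rel: "okft \<gamma> \<Longrightarrow> rel \<gamma> \<in> rels \<sigma>"
proof (cases \<gamma>)
  case (Init R xs)
  then show "okft \<gamma> \<Longrightarrow> ?thesis" using inst by (auto simp: is_instance_def)
next
  case (Cr s R p)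
  then show "okft \<gamma> \<Longrightarrow> ?thesis" using up_Pos[of "(R, p)" s] by (simp add: Pos_iff)
qed

lemma okft_ty:
  assumes "okft \<gamma>" "i < ar \<gamma>"
  shows "okst (ty \<gamma> i)" "(rel \<gamma>, i) \<in> up (ty \<gamma> i)"
proof -
  have P: "(rel \<gamma>, i) \<in> Pos \<sigma>" using assms okft_rel by (simp add: Pos_iff)
  have "okst (ty \<gamma> i) \<and> (rel \<gamma>, i) \<in> up (ty \<gamma> i)"
  proof (cases \<gamma>)
    case (Init R xs)
    then have "length xs = arity \<sigma> R" using inst assms by (auto simp: is_instance_def)
    then have "okst [EInit (xs ! i)]" using okst_Init[of R xs "xs ! i"] assms Init by simp
    moreover have "xs ! i \<in> proj I\<^sub>0 (R, i)" using assms Init projI by simp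
    moreover have "uid (R, i) (R, i)" using P Init by simp
    ultimately show ?thesis using Init by auto
  next
    case (Cr s R p)
    show ?thesis
    proof (cases "i = p")
      case False
      then have "okst (nxt s R p i)" using assms Cr by (intro okst_nxt) auto
      then show ?thesis using P up_nxt False Cr by simp
    qed (use assms Cr in simp)
  qed
  then show "okst (ty \<gamma> i)" "(rel \<gamma>, i) \<in> up (ty \<gamma> i)" by auto
qed

lemma okst_length: "okst s \<Longrightarrow> length s \<le> K"
  by (induction rule: okst.induct) (use K_pos in \<open>auto simp: nxt_def simp del: take_Suc_Cons\<close>)

lemma okst_events:
  "okst s \<Longrightarrow> set s \<subseteq> EInit ` (\<Union>(R, xs) \<in> I\<^sub>0. set xs) \<union> EZ ` Pow (Pos \<sigma>)
     \<union> (\<lambda>(R, p, j). EStep R p j) ` (SIGMA R : rels \<sigma>. {..<arity \<sigma> R} \<times> {..<arity \<sigma> R})"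
  (is "_ \<Longrightarrow> _ \<subseteq> ?E")
proof (induction rule: okst.induct)
  case (okst_Init R xs a)
  then show ?case by auto
next
  case (okst_Z P)
  then show ?case using cls_Pos[of P] by simp
next
  case (okst_nxt s R p j)
  have "R \<in> rels \<sigma>" "p < arity \<sigma> R" using up_Pos[OF okst_nxt.hyps(2)] by (auto simp: Pos_iff)
  then have "EStep R p j \<in> ?E" using okst_nxt.hyps(3) by (force simp: image_iff)
  then have "set (EStep R p j # s) \<subseteq> ?E" using okst_nxt.IH by simp
  moreover have "EZ (cls (R, j)) \<in> ?E" using cls_Pos[of "(R, j)"] by simp
  moreover have "set (nxt s R p j) \<subseteq> insert (EZ (cls (R, j))) (set (EStep R p j # s))"
  proof (cases "forget s R p j")
    case False
    then show ?thesis unfolding nxt_def if_not_P[OF False] by (intro subset_insertI2 set_take_subset)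
  qed (simp add: nxt_def)
  ultimately show ?case by blast
qed

lemma finite_okst: "finite {s. okst s}"
proof -
  let ?E = "EInit ` (\<Union>(R, xs) \<in> I\<^sub>0. set xs) \<union> EZ ` Pow (Pos \<sigma>)
     \<union> (\<lambda>(R, p, j). EStep R p j) ` (SIGMA R : rels \<sigma>. {..<arity \<sigma> R} \<times> {..<arity \<sigma> R})"
  have "finite ?E"
    using fin_I\<^sub>0 finite_Pos[OF wf] wf by (auto simp: wf_schema_def)
  then have "finite {s. set s \<subseteq> ?E \<and> length s \<le> K}" by (rule finite_lists_length_le)
  then show ?thesis by (rule rev_finite_subset) (use okst_events okst_length in blast)
qed

lemma finite_okft: "finite {\<gamma>. okft \<gamma>}"
proof (rule finite_subset)
  let ?S = "(\<lambda>(R, xs). Init R xs) ` I\<^sub>0 \<union> (\<lambda>(s, R, p). Cr s R p) ` ({s. okst s} \<times> Pos \<sigma>)"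
  show "{\<gamma>. okft \<gamma>} \<subseteq> ?S"
  proof
    fix \<gamma> assume "\<gamma> \<in> {\<gamma>. okft \<gamma>}"
    then show "\<gamma> \<in> ?S" using up_Pos by (cases \<gamma>) (force simp: image_iff)+
  qed
  show "finite ?S" using fin_I\<^sub>0 finite_okst finite_Pos[OF wf] by simp
qed

section \<open>Matching histories in a model\<close>

lemma hom_at_up:
  assumes J: "model J" and s: "okst s" and h: "hom_at J (Suc n) s y" and Q: "Q \<in> up s"
  shows "y \<in> proj J Q"
proof (cases s)
  case (Cons e t)
  show ?thesis
  proof (cases e)
    case (EInit a)
    then have "\<exists>P. a \<in> proj I\<^sub>0 P \<and> uid P Q" using Q Cons by simp
    then obtain P where P: "a \<in> proj I\<^sub>0 P" "uid P Q" by blast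
    have "proj I\<^sub>0 P \<subseteq> proj J P" using model_sub[OF J] by (auto simp: proj_def)
    moreover have "y = a" using h Cons EInit by simp
    ultimately show ?thesis using P(1) model_uid[OF J P(2)] by blast
  next
    case (EZ c)
    then have "\<exists>P \<in> c. y \<in> proj J P" "\<exists>P \<in> c. uid P Q" using Q h Cons by simp_all
    then obtain P P' where P: "P \<in> c" "y \<in> proj J P" "P' \<in> c" "uid P' Q" by blast
    moreover obtain S where "c = cls S" using okst_Z_form s Cons EZ by blast
    ultimately have "uid P P'" using uid_trans[of P S P'] by (simp add: cls_def)
    then have "uid P Q" using uid_trans P(4) by blast
    then show ?thesis using model_uid[OF J] P(2) by blast
  next
    case (EStep R p j)
    then have "\<exists>ys. (R, ys) \<in> J \<and> ys ! j = y" using h Cons by auto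
    then obtain ys where ys: "(R, ys) \<in> J" "ys ! j = y" by blast
    have "y \<in> proj J (R, j)" using projI[OF ys(1), of j] ys(2) by simp
    moreover have "uid (R, j) Q" using Q Cons EStep by simp
    ultimately show ?thesis using model_uid[OF J] by blast
  qed
qed (use Q in simp)

text \<open>Backwards through the history: the reversed UID puts \<open>y\<close> at the position
  where the latest step created it, the fact found there has a predecessor at \<open>(R, p)\<close>,
  and the induction continues from that element.\<close>

lemma hom_at_run:
  assumes J: "model J"
  shows "n \<le> run s \<Longrightarrow> 0 < n \<Longrightarrow> linked P s \<Longrightarrow> y \<in> proj J P \<Longrightarrow> hom_at J n s y"
proof (induction s arbitrary: n P y)
  case (Cons e s)
  obtain R p j where e: "e = EStep R p j" using Cons.prems(1,2) by (cases e) auto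
  obtain m where m: "n = Suc m" using Cons.prems(2) by (cases n) auto
  have eq: "eqv R j p" using Cons.prems(1) m e by (auto split: if_splits)
  have "uid P (R, j)" using Cons.prems(3) e by (simp add: cls_def)
  then have "y \<in> proj J (R, j)" using Cons.prems(4) model_uid[OF J] by blast
  then obtain ys where ys: "(R, ys) \<in> J" "ys ! j = y" by (rule projE)
  have "hom_at J m s (ys ! p)"
  proof (cases "m = 0")
    case False
    then have "m \<le> run s" "linked (R, p) s" using Cons.prems(1) e m eq by (auto split: if_splits)
    then show ?thesis using False Cons.IH[of m "(R, p)" "ys ! p"] projI[OF ys(1)] by simp
  qed simp
  then show ?case using ys e m by auto
qed simp

lemma hom_at_Z:
  assumes "model J" "0 < n" "(R, ys) \<in> J" "(R, i) \<in> Pos \<sigma>"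
  shows "hom_at J n [EZ (cls (R, i))] (ys ! i)"
proof -
  have "(R, i) \<in> cls (R, i)" using assms(4) by simp
  then show ?thesis using projI[OF assms(3), of i] assms(2) by (cases n) (simp, auto)
qed

text \<open>No event is lost in this direction: the history at \<open>i\<close> is either forgotten
  or that at \<open>p\<close> preceded by one event, and \<open>ys\<close> itself witnesses that
  event.\<close>

lemma hom_at_ty:
  assumes J: "model J" and n: "n \<le> K" and ys: "(R, ys) \<in> J" and s: "okst s" "(R, p) \<in> up s"
    and i: "i < arity \<sigma> R" and h: "hom_at J n s (ys ! p)"
  shows "hom_at J n (ty (Cr s R p) i) (ys ! i)"
proof (cases "i = p")
  case False
  have "hom_at J n (nxt s R p i) (ys ! i)"
  proof (cases "forget s R p i")
    case True
    then show ?thesis using hom_at_Z[OF J _ ys, of n i] up_Pos[OF s(2)] i Pos_other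
      by (cases "n = 0") (auto simp: nxt_def)
  next
    case False
    then have "nxt s R p i = take K (EStep R p i # s)" by (simp add: nxt_def)
    moreover have "hom_at J n (EStep R p i # s) (ys ! i)"
    proof (cases n)
      case (Suc m)
      then have "hom_at J m s (ys ! p)" using h by (simp add: hom_at_Suc)
      then show ?thesis using Suc ys by auto
    qed simp
    ultimately show ?thesis by (simp add: hom_at_take[OF n] del: take_Suc_Cons hom_at.simps)
  qed
  then show ?thesis using False by simp
qed (use h in simp)

text \<open>The partial matches \<open>hom_at J n\<close> form a simulation: a match of one element of a typed fact
  extends to the whole fact, at the price of one step of history.\<close>

lemma hom_at_extend:
  assumes J: "model J" and ok: "okst s" "(R, p) \<in> up s" and q: "q < arity \<sigma> R" and n: "n < K"
    and h: "hom_at J (Suc n) (ty (Cr s R p) q) y"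
  obtains ys where "(R, ys) \<in> J" "ys ! q = y"
    "\<And>i. i < arity \<sigma> R \<Longrightarrow> hom_at J n (ty (Cr s R p) i) (ys ! i)"
proof -
  have Rq: "(R, q) \<in> Pos \<sigma>" using up_Pos[OF ok(2)] q by (rule Pos_other)
  have "\<exists>ys. (R, ys) \<in> J \<and> ys ! q = y \<and> hom_at J n s (ys ! p)"
  proof (cases "q = p")
    case True
    then have h': "hom_at J (Suc n) s y" using h by simp
    then have "y \<in> proj J (R, p)" using hom_at_up[OF J ok(1)] ok(2) by blast
    then obtain ys where ys: "(R, ys) \<in> J" "ys ! p = y" by (rule projE)
    then have "hom_at J n s (ys ! p)" using hom_at_Suc[OF h'] by simp
    then show ?thesis using ys True by blast
  next
    case False
    then have h': "hom_at J (Suc n) (nxt s R p q) y" using h by simp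
    show ?thesis
    \<comment> \<open>The critical case is a forgotten history: \<open>y\<close> only yields some
      fact with \<open>y\<close> at \<open>q\<close>, so the match at \<open>p\<close> has to be
      found anew. It exists because \<open>s\<close> is itself forgotten or its latest events form a
      run that can be retraced from \<open>p\<close>.\<close>
    proof (cases "forget s R p q")
      case True
      then have "\<exists>P \<in> cls (R, q). y \<in> proj J P" using h' by (simp add: nxt_def)
      then obtain P where P: "P \<in> cls (R, q)" "y \<in> proj J P" by blast
      then have "y \<in> proj J (R, q)" using model_uid[OF J, of P "(R, q)"] by (simp add: cls_def)
      then obtain ys where ys: "(R, ys) \<in> J" "ys ! q = y" by (rule projE)
      have "hom_at J n s (ys ! p)"
      proof (cases "n = 0")
        case n0: False
        from True consider c where "s = [EZ c]" "(R, p) \<in> c" | "K \<le> run (EStep R p q # s)"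
          unfolding forget_def by blast
        then show ?thesis
        proof cases
          case 1
          then show ?thesis using projI[OF ys(1), of p] by (cases n) auto
        next
          case 2
          \<comment> \<open>If \<open>s\<close> were not linked, the run would have length at most
            1, which \<open>0 < n < K\<close> excludes; so \<open>run s\<close> is at least
            \<open>K - 1\<close>.\<close>
          then have "n \<le> run s" "linked (R, p) s" using n n0 by (auto split: if_splits)
          then show ?thesis using hom_at_run[OF J] n0 projI[OF ys(1)] by blast
        qed
      qed simp
      then show ?thesis using ys by blast
    next
      case False
      then have "hom_at J (Suc n) (EStep R p q # s) y"
        using h' hom_at_take[of "Suc n" K J "EStep R p q # s" y] n by (simp add: nxt_def del: hom_at.simps)
      then show ?thesis by auto
    qed
  qed
  then obtain ys where ys: "(R, ys) \<in> J" "ys ! q = y" "hom_at J n s (ys ! p)" by blast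
  show ?thesis
    using that[OF ys(1,2)] hom_at_ty[OF J _ ys(1) ok _ ys(3)] n by simp
qed

lemma okst_hom_at:
  assumes J: "model J"
  shows "okst s \<Longrightarrow> \<exists>y. hom_at J K s y"
proof (induction rule: okst.induct)
  case (okst_Init R xs a)
  have "hom_at J K [EInit a] a" using K_pos by (cases K) auto
  then show ?case by blast
next
  case (okst_Z P)
  obtain R p where P: "P = (R, p)" by (cases P)
  obtain ys where "(R, ys) \<in> J" using okst_Z.hyps(2) J P by (auto simp: reach_def)
  then show ?case using hom_at_Z[OF J K_pos] okst_Z.hyps(1) P by blast
next
  case (okst_nxt s R p j)
  then obtain y where y: "hom_at J K s y" by blast
  then have "hom_at J (Suc (K - 1)) s y" using K_pos by simp
  then have "y \<in> proj J (R, p)" using hom_at_up[OF J okst_nxt.hyps(1) _ okst_nxt.hyps(2)] by blast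
  then obtain ys where ys: "(R, ys) \<in> J" "ys ! p = y" by (rule projE)
  then have "hom_at J K (ty (Cr s R p) j) (ys ! j)"
    using hom_at_ty[OF J order_refl ys(1) okst_nxt.hyps(1-3)] y by simp
  then show ?case using okst_nxt.hyps(4) by auto
qed

end

section \<open>Units\<close>

text \<open>A partial structure has natural numbers as elements. Its facts are typed and may be undefined
  at some positions; those are filled later by elements that are shared with other structures.\<close>

record ('r, 'a) pstruct =
  elems :: "nat set"
  state :: "nat \<Rightarrow> ('r, 'a) event list"
  facts :: "(('r, 'a) ftype \<times> (nat \<rightharpoonup> nat)) set"

definition occ :: "('r, 'a) pstruct \<Rightarrow> 'r position \<Rightarrow> nat set" where
  "occ D Q = {x. \<exists>\<gamma> m. (\<gamma>, m) \<in> facts D \<and> rel \<gamma> = fst Q \<and> m (snd Q) = Some x}"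

locale pstruct_base = fin_closed \<sigma> \<Sigma> I\<^sub>0 K
  for \<sigma> :: "'r schema" and \<Sigma> and I\<^sub>0 :: "('r, 'a) fact set" and K +
  fixes \<iota> :: "'a \<Rightarrow> nat"
  assumes inj_\<iota>: "inj_on \<iota> (\<Union>(R, xs) \<in> I\<^sub>0. set xs)"
begin

section \<open>Requirements and the invariant of a unit\<close>

definition need :: "('r, 'a) pstruct \<Rightarrow> 'r position \<Rightarrow> nat set" where
  "need D Q = {x \<in> elems D. Q \<in> up (state D x)}"

definition lack :: "('r, 'a) pstruct \<Rightarrow> 'r position \<Rightarrow> nat set" where
  "lack D Q = need D Q - occ D Q"

fun dm :: "('r, 'a) ftype \<Rightarrow> nat set" where
  "dm (Init R xs) = {..<arity \<sigma> R}"
| "dm (Cr s R p) = {i. ufd R i p}"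

definition initm :: "'a list \<Rightarrow> nat \<rightharpoonup> nat" where
  "initm xs = (\<lambda>i. if i < length xs then Some (\<iota> (xs ! i)) else None)"

text \<open>\<open>Bs\<close> holds the facts from which the unit starts; only they may fill a set
  of positions other than \<open>dm\<close>. The last conjunct secures the FDs: facts of one
  relation with a common element at one position are equal or both initial, and the initial ones
  inherit their FDs from \<open>I\<^sub>0\<close>.\<close>

definition inv :: "(('r, 'a) ftype \<times> (nat \<rightharpoonup> nat)) set \<Rightarrow> ('r, 'a) pstruct \<Rightarrow> bool" where
  "inv Bs D \<longleftrightarrow> finite (elems D) \<and> finite (facts D) \<and> Bs \<subseteq> facts D \<and>
     (\<forall>x \<in> elems D. okst (state D x)) \<and>
     (\<forall>\<gamma> m. (\<gamma>, m) \<in> facts D \<longrightarrow> okft \<gamma> \<and>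
        (\<forall>i x. m i = Some x \<longrightarrow> i < ar \<gamma> \<and> x \<in> elems D \<and> state D x = ty \<gamma> i) \<and>
        (dom m = dm \<gamma> \<or> (\<gamma>, m) \<in> Bs) \<and>
        (\<forall>i j. i \<in> dom m \<longrightarrow> eqv (rel \<gamma>) i j \<longrightarrow> j \<in> dom m) \<and>
        (\<forall>R xs. \<gamma> = Init R xs \<longrightarrow> m = initm xs)) \<and>
     (\<forall>\<gamma> m \<gamma>' m' i x. (\<gamma>, m) \<in> facts D \<longrightarrow> (\<gamma>', m') \<in> facts D \<longrightarrow> rel \<gamma> = rel \<gamma>' \<longrightarrow>
        m i = Some x \<longrightarrow> m' i = Some x \<longrightarrow>
        (\<gamma>, m) = (\<gamma>', m') \<or> (\<exists>R xs ys. \<gamma> = Init R xs \<and> \<gamma>' = Init R ys))"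

lemma inv_finite: "inv Bs D \<Longrightarrow> finite (elems D) \<and> finite (facts D)"
  unfolding inv_def by blast

lemma inv_base: "inv Bs D \<Longrightarrow> Bs \<subseteq> facts D"
  unfolding inv_def by blast

lemma inv_okst: "inv Bs D \<Longrightarrow> x \<in> elems D \<Longrightarrow> okst (state D x)"
  unfolding inv_def by blast

lemma inv_fact:
  assumes "inv Bs D" "(\<gamma>, m) \<in> facts D"
  shows "okft \<gamma>" "dom m = dm \<gamma> \<or> (\<gamma>, m) \<in> Bs"
    "i \<in> dom m \<Longrightarrow> eqv (rel \<gamma>) i j \<Longrightarrow> j \<in> dom m"
    "\<gamma> = Init R xs \<Longrightarrow> m = initm xs"
    "m i = Some x \<Longrightarrow> i < ar \<gamma> \<and> x \<in> elems D \<and> state D x = ty \<gamma> i"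
  using assms unfolding inv_def by blast+

lemma inv_linear:
  assumes "inv Bs D" "(\<gamma>, m) \<in> facts D" "(\<gamma>', m') \<in> facts D" "rel \<gamma> = rel \<gamma>'"
    "m i = Some x" "m' i = Some x"
  shows "(\<gamma>, m) = (\<gamma>', m') \<or> (\<exists>R xs ys. \<gamma> = Init R xs \<and> \<gamma>' = Init R ys)"
  using assms unfolding inv_def by blast

lemma invI:
  assumes "finite (elems D)" "finite (facts D)" "Bs \<subseteq> facts D"
    and "\<And>x. x \<in> elems D \<Longrightarrow> okst (state D x)"
    and "\<And>\<gamma> m. (\<gamma>, m) \<in> facts D \<Longrightarrow> okft \<gamma>"
    and "\<And>\<gamma> m i x. (\<gamma>, m) \<in> facts D \<Longrightarrow> m i = Some x \<Longrightarrow> i < ar \<gamma> \<and> x \<in> elems D \<and> state D x = ty \<gamma> i"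
    and "\<And>\<gamma> m. (\<gamma>, m) \<in> facts D \<Longrightarrow> dom m = dm \<gamma> \<or> (\<gamma>, m) \<in> Bs"
    and "\<And>\<gamma> m i j. (\<gamma>, m) \<in> facts D \<Longrightarrow> i \<in> dom m \<Longrightarrow> eqv (rel \<gamma>) i j \<Longrightarrow> j \<in> dom m"
    and "\<And>m R xs. (Init R xs, m) \<in> facts D \<Longrightarrow> m = initm xs"
    and "\<And>\<gamma> m \<gamma>' m' i x. (\<gamma>, m) \<in> facts D \<Longrightarrow> (\<gamma>', m') \<in> facts D \<Longrightarrow> rel \<gamma> = rel \<gamma>' \<Longrightarrow>
        m i = Some x \<Longrightarrow> m' i = Some x \<Longrightarrow>
        (\<gamma>, m) = (\<gamma>', m') \<or> (\<exists>R xs ys. \<gamma> = Init R xs \<and> \<gamma>' = Init R ys)"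
  shows "inv Bs D"
  unfolding inv_def
  apply (intro conjI allI impI ballI)
             apply (fact assms(1-3))+
           apply (rule assms(4), assumption)
          apply (rule assms(5), assumption)
         apply (drule (1) assms(6), blast)+
      apply (rule assms(7), assumption)
     apply (rule assms(8); assumption)
    apply (hypsubst, rule assms(9), assumption)
   apply (rule assms(10); assumption)
  done

lemma lack_Pos: "x \<in> lack D Q \<Longrightarrow> Q \<in> Pos \<sigma>"
  using up_Pos[of Q "state D x"] by (simp add: lack_def need_def)

lemma lackD: "x \<in> lack D Q \<Longrightarrow> x \<in> elems D \<and> Q \<in> up (state D x)"
  by (simp add: lack_def need_def)

lemma finite_lack: "inv Bs D \<Longrightarrow> finite (lack D Q)"
  using inv_finite[of Bs D] by (simp add: lack_def need_def)

lemma occ_need: "inv Bs D \<Longrightarrow> occ D Q \<subseteq> need D Q"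
proof
  fix x assume D: "inv Bs D" and "x \<in> occ D Q"
  then obtain \<gamma> m where f: "(\<gamma>, m) \<in> facts D" "rel \<gamma> = fst Q" "m (snd Q) = Some x"
    unfolding occ_def by blast
  note g = inv_fact(1)[OF D f(1)] inv_fact(5)[OF D f(1,3)]
  then have "(rel \<gamma>, snd Q) \<in> up (ty \<gamma> (snd Q))" using okft_ty(2) by blast
  then show "x \<in> need D Q" using g f(2) by (simp add: need_def)
qed

text \<open>The common step of the fresh and the closing phase: \<open>c\<close> names the old
  elements to be reused, and every other position that determines \<open>p\<close> gets a fresh one.
  A reused element must lack its position, which preserves linearity, and must have the state that
  the type prescribes.\<close>

lemma add_fact:
  assumes D: "inv Bs D" and s: "okst s" "(R, p) \<in> up s"
    and c: "p \<in> dom c" "\<And>i x. c i = Some x \<Longrightarrow> ufd R i p \<and> x \<in> lack D (R, i) \<and> state D x = ty (Cr s R p) i"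
  obtains D' where "inv Bs D'" "elems D \<subseteq> elems D'" "\<And>x. x \<in> elems D \<Longrightarrow> state D' x = state D x"
    "\<And>Q. lack D' Q \<inter> elems D = lack D Q - {x. fst Q = R \<and> c (snd Q) = Some x}"
    "\<And>Q x. x \<in> lack D' Q \<Longrightarrow> x \<notin> elems D \<Longrightarrow>
       \<exists>i. ufd R i p \<and> c i = None \<and> uid (R, i) Q \<and> Q \<noteq> (R, i) \<and> state D' x = nxt s R p i"
proof -
  define \<gamma> where "\<gamma> = Cr s R p"
  define N where "N = Suc (Max (insert 0 (elems D)))"
  have N: "x < N" if "x \<in> elems D" for x
    unfolding N_def using that inv_finite[OF D] by (simp add: less_Suc_eq_le)
  define m where "m = (\<lambda>i. if c i = None \<and> ufd R i p then Some (N + i) else c i)"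
  define D' where "D' = \<lparr>elems = elems D \<union> (\<lambda>i. N + i) ` {i. ufd R i p \<and> c i = None},
    state = (\<lambda>x. if x \<in> elems D then state D x else ty \<gamma> (x - N)),
    facts = insert (\<gamma>, m) (facts D)\<rparr>"
  have new: "N + i \<notin> elems D" for i using N[of "N + i"] by auto
  have \<gamma>: "okft \<gamma>" "rel \<gamma> = R" "dm \<gamma> = {i. ufd R i p}" using s by (simp_all add: \<gamma>_def)
  have cx: "x \<in> elems D" "x \<notin> occ D (R, i)" if "c i = Some x" for i x
    using c(2)[OF that] by (simp_all add: lack_def need_def)
  have m_old: "m i = Some x \<longleftrightarrow> c i = Some x" if "x \<in> elems D" for i x
    using that new unfolding m_def by auto
  have m_cases: "c i = Some x \<or> (c i = None \<and> ufd R i p \<and> x = N + i)" if "m i = Some x" for i x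
    using that unfolding m_def by (auto split: if_splits)
  have dom_m: "dom m = {i. ufd R i p}"
  proof (intro equalityI subsetI)
    fix i assume "i \<in> dom m"
    then obtain x where "m i = Some x" by blast
    then show "i \<in> {i. ufd R i p}" using m_cases[of i x] c(2)[of i x] by blast
  next
    fix i assume "i \<in> {i. ufd R i p}"
    then show "i \<in> dom m" unfolding m_def by (cases "c i") auto
  qed
  have lt: "ufd R i p \<Longrightarrow> i < arity \<sigma> R" for i using ufd_Pos[of R i p] by (simp add: Pos_iff)
  have inv_D': "inv Bs D'"
  proof (rule invI)
    have "{i. ufd R i p \<and> c i = None} \<subseteq> {..<arity \<sigma> R}" using lt by blast
    then have "finite {i. ufd R i p \<and> c i = None}" by (rule finite_subset) simp
    then show "finite (elems D')" "finite (facts D')"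
      using inv_finite[OF D] by (simp_all add: D'_def)
    show "Bs \<subseteq> facts D'" using inv_base[OF D] by (auto simp: D'_def)
    show "okst (state D' x)" if x: "x \<in> elems D'" for x
    proof (cases "x \<in> elems D")
      case True
      then show ?thesis using inv_okst[OF D] by (simp add: D'_def)
    next
      case False
      then obtain i where i: "ufd R i p" "x = N + i" using x unfolding D'_def by auto
      then have "okst (ty \<gamma> i)" using okft_ty(1)[OF \<gamma>(1)] \<gamma>(2) lt by simp
      then show ?thesis using new i by (simp add: D'_def)
    qed
    fix \<delta> n assume "(\<delta>, n) \<in> facts D'"
    then consider "(\<delta>, n) \<in> facts D" | "\<delta> = \<gamma>" "n = m" unfolding D'_def by auto
    note fact = this
    show "okft \<delta>" using fact by cases (use inv_fact(1)[OF D] \<gamma> in auto)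
    show "i < ar \<delta> \<and> x \<in> elems D' \<and> state D' x = ty \<delta> i" if x: "n i = Some x" for i x
      using fact
    proof cases
      case 1
      then show ?thesis using inv_fact(5)[OF D 1 x] by (simp add: D'_def)
    next
      case 2
      then have "m i = Some x" using x by simp
      then show ?thesis
      proof (cases "c i = Some x")
        case True
        then show ?thesis using c(2)[OF True] cx[OF True] lt 2 \<gamma> by (simp add: D'_def \<gamma>_def)
      next
        case False
        then have "c i = None" "ufd R i p" "x = N + i" using m_cases[OF \<open>m i = Some x\<close>] by auto
        then show ?thesis using lt new 2 \<gamma> by (simp add: D'_def)
      qed
    qed
    show "dom n = dm \<delta> \<or> (\<delta>, n) \<in> Bs" using fact
      by cases (use inv_fact(2)[OF D] \<gamma> dom_m in auto)
    show "j \<in> dom n" if ij: "i \<in> dom n" "eqv (rel \<delta>) i j" for i j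
      using fact
    proof cases
      case 1
      then show ?thesis using inv_fact(3)[OF D 1] ij by blast
    next
      case 2
      then show ?thesis using ij \<gamma> dom_m ufd_trans[of R j i p] by (simp add: eqv_def)
    qed
  next
    fix n S xs assume "(Init S xs, n) \<in> facts D'"
    then have "(Init S xs, n) \<in> facts D" by (simp add: D'_def \<gamma>_def)
    then show "n = initm xs" using inv_fact(4)[OF D] by blast
  next
    \<comment> \<open>An element that the new fact shares with an old one at the same position must
      be a reused one, but those lacked exactly this position.\<close>
    have clash: False if "(\<delta>, n) \<in> facts D" "rel \<delta> = R" "n i = Some x" "m i = Some x" for \<delta> n i x
    proof -
      have "x \<in> elems D" using inv_fact(5)[OF D that(1,3)] by simp
      then have "c i = Some x" using m_old that(4) by simp
      moreover have "x \<in> occ D (R, i)" using that unfolding occ_def by auto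
      ultimately show False using cx by blast
    qed
    fix \<delta> n \<delta>' n' i x
    assume a: "(\<delta>, n) \<in> facts D'" "(\<delta>', n') \<in> facts D'" "rel \<delta> = rel \<delta>'" "n i = Some x" "n' i = Some x"
    then consider "(\<delta>, n) \<in> facts D" "(\<delta>', n') \<in> facts D" | "(\<delta>, n) \<in> facts D" "\<delta>' = \<gamma>" "n' = m"
      | "\<delta> = \<gamma>" "n = m" "(\<delta>', n') \<in> facts D" | "(\<delta>, n) = (\<delta>', n')"
      unfolding D'_def by auto
    then show "(\<delta>, n) = (\<delta>', n') \<or> (\<exists>R xs ys. \<delta> = Init R xs \<and> \<delta>' = Init R ys)"
    proof cases
      case 1
      then show ?thesis using inv_linear[OF D 1 a(3-5)] by blast
    next
      case 2
      then show ?thesis using clash[OF 2(1), of i x] a \<gamma> by simp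
    next
      case 3
      then show ?thesis using clash[OF 3(3), of i x] a \<gamma> by simp
    qed blast
  qed
  have occ': "occ D' Q = occ D Q \<union> {x. fst Q = R \<and> m (snd Q) = Some x}" for Q
  proof (intro equalityI subsetI)
    fix x assume "x \<in> occ D Q \<union> {x. fst Q = R \<and> m (snd Q) = Some x}"
    then show "x \<in> occ D' Q" unfolding occ_def D'_def using \<gamma>(2) by (simp, blast)
  qed (use \<gamma>(2) in \<open>auto simp: occ_def D'_def\<close>)
  show ?thesis
  proof (rule that[OF inv_D'])
    show "elems D \<subseteq> elems D'" by (auto simp: D'_def)
    show "state D' x = state D x" if "x \<in> elems D" for x using that by (simp add: D'_def)
    show "lack D' Q \<inter> elems D = lack D Q - {x. fst Q = R \<and> c (snd Q) = Some x}" for Q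
      using m_old unfolding lack_def occ' need_def by (auto simp: D'_def)
    show "\<exists>i. ufd R i p \<and> c i = None \<and> uid (R, i) Q \<and> Q \<noteq> (R, i) \<and> state D' x = nxt s R p i"
      if x: "x \<in> lack D' Q" "x \<notin> elems D" for x Q
    proof -
      obtain i where i: "ufd R i p" "c i = None" "x = N + i"
        using x unfolding lack_def need_def D'_def by auto
      have "i \<noteq> p" using i(2) c(1) by auto
      then have st: "state D' x = nxt s R p i" using new i by (simp add: D'_def \<gamma>_def)
      have "(R, i) \<in> Pos \<sigma>" using ufd_Pos[OF i(1)] by simp
      then have "uid (R, i) Q" using lackD[OF x(1)] st up_nxt by simp
      moreover have "Q \<noteq> (R, i)" using x(1) i unfolding lack_def occ' by (auto simp: m_def)
      ultimately show ?thesis using i st by blast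
    qed
  qed
qed

text \<open>Requirements are met rank by rank. Within a rank, fresh facts are added for \<open>K\<close> rounds, until only
  elements with a forgotten history lack facts. Then the structure is padded with such elements until
  equally many are missing at equivalent positions, and each new fact takes up one missing element
  at each of these.\<close>

definition sat_below :: "nat \<Rightarrow> ('r, 'a) pstruct \<Rightarrow> bool" where
  "sat_below r D \<longleftrightarrow> (\<forall>Q. rank Q < r \<longrightarrow> lack D Q = {})"

section \<open>Fresh facts until every lacking element has forgotten its history\<close>

definition zrole :: "('r, 'a) event list \<Rightarrow> 'r position \<Rightarrow> bool" where
  "zrole s Q \<longleftrightarrow> (\<exists>c. s = [EZ c] \<and> Q \<in> c)"

text \<open>Progress towards a forgotten history. A fresh element with a lack of the same rank has a
  higher level than the element that required it, and level \<open>K\<close> forces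
  \<open>zrole\<close>, since runs in reachable states are shorter than \<open>K\<close>.\<close>

definition level :: "('r, 'a) event list \<Rightarrow> 'r position \<Rightarrow> nat" where
  "level s Q = (if zrole s Q then K else if linked Q s then run s else 0)"

definition level_ge :: "nat \<Rightarrow> nat \<Rightarrow> ('r, 'a) pstruct \<Rightarrow> bool" where
  "level_ge r d D \<longleftrightarrow> (\<forall>Q x. rank Q = r \<longrightarrow> x \<in> lack D Q \<longrightarrow> d \<le> level (state D x) Q)"

lemma sat_belowD: "sat_below r D \<Longrightarrow> rank Q < r \<Longrightarrow> lack D Q = {}"
  unfolding sat_below_def by blast

lemma level_geD: "level_ge r d D \<Longrightarrow> rank Q = r \<Longrightarrow> x \<in> lack D Q \<Longrightarrow> d \<le> level (state D x) Q"
  unfolding level_ge_def by blast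

text \<open>The FD and the UID both lead upwards in \<open>dominated\<close>. Hence a new fact never
  creates needs of lower rank, and it creates needs of the same rank only through reversible
  dependencies.\<close>

lemma rank_between:
  assumes "ufd R i p" "uid (R, i) Q"
  shows "rank (R, p) \<le> rank Q"
    "rank Q = rank (R, p) \<Longrightarrow> eqv R i p \<and> Q \<in> cls (R, i)"
proof -
  note r = ufd_rank[OF assms(1)] uid_rank[OF assms(2)]
  then show "rank (R, p) \<le> rank Q" by simp
  assume "rank Q = rank (R, p)"
  then have "rank (R, p) = rank (R, i)" "rank (R, i) = rank Q" using r by auto
  then show "eqv R i p \<and> Q \<in> cls (R, i)"
    using assms ufd_reversible[OF assms(1)] uid_reversible[OF assms(2)] by (simp add: eqv_def cls_def)
qed

lemma level_nxt:
  assumes "Q \<in> cls (R, i)" "eqv R i p" "level s (R, p) < K"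
  shows "level s (R, p) < level (nxt s R p i) Q"
proof (cases "forget s R p i")
  case True
  then have "zrole (nxt s R p i) Q" using assms(1) by (simp add: nxt_def zrole_def)
  then show ?thesis using assms(3) by (simp add: level_def)
next
  case False
  have "\<not> zrole s (R, p)" using assms(3) by (auto simp: level_def)
  then have l: "level s (R, p) = (if linked (R, p) s then run s else 0)" by (simp add: level_def)
  obtain k where k: "K = Suc k" using K_pos by (cases K) auto
  have n: "nxt s R p i = take K (EStep R p i # s)" using False by (simp add: nxt_def)
  have "\<not> zrole (nxt s R p i) Q" unfolding n using k by (simp add: zrole_def)
  moreover have "(R, i) \<in> cls Q" using assms(1) by (simp add: cls_def)
  then have "linked Q (nxt s R p i)" unfolding n linked_take using K_pos by simp
  moreover have "run (nxt s R p i) = Suc (level s (R, p))"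
    using False assms(2) l by (simp add: run_nxt)
  ultimately show ?thesis by (simp add: level_def)
qed

lemma ball_step:
  assumes D: "inv Bs D" "sat_below r D" "level_ge r d D" "d < K"
    and x: "x \<in> lack D (R, p)" "rank (R, p) = r" "level (state D x) (R, p) = d"
  obtains D' where "inv Bs D'" "sat_below r D'" "level_ge r d D'"
    "{(y, Q). rank Q = r \<and> y \<in> lack D' Q \<and> level (state D' y) Q = d} \<subseteq>
     {(y, Q). rank Q = r \<and> y \<in> lack D Q \<and> level (state D y) Q = d} - {(x, R, p)}"
proof -
  have okx: "okst (state D x)" "(R, p) \<in> up (state D x)" and Rp: "(R, p) \<in> Pos \<sigma>"
    using lackD[OF x(1)] lack_Pos[OF x(1)] inv_okst[OF D(1)] by auto
  define c where "c = [p \<mapsto> x]"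
  have c: "p \<in> dom c" "\<And>i y. c i = Some y \<Longrightarrow> ufd R i p \<and> y \<in> lack D (R, i) \<and> state D y = ty (Cr (state D x) R p) i"
    using x(1) Rp by (auto simp: c_def split: if_splits)
  show ?thesis
  proof (rule add_fact[OF D(1) okx c])
    fix D' assume D': "inv Bs D'" "elems D \<subseteq> elems D'" "\<And>y. y \<in> elems D \<Longrightarrow> state D' y = state D y"
      and old: "\<And>Q. lack D' Q \<inter> elems D = lack D Q - {y. fst Q = R \<and> c (snd Q) = Some y}"
      and new: "\<And>Q y. y \<in> lack D' Q \<Longrightarrow> y \<notin> elems D \<Longrightarrow>
         \<exists>i. ufd R i p \<and> c i = None \<and> uid (R, i) Q \<and> Q \<noteq> (R, i) \<and> state D' y = nxt (state D x) R p i"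
    have new_rank: "r \<le> rank Q" if "y \<in> lack D' Q" "y \<notin> elems D" for y Q
      using new[OF that] rank_between(1)[of R _ p Q] x(2) by auto
    have new_level: "d < level (state D' y) Q" if yQ: "y \<in> lack D' Q" "y \<notin> elems D" "rank Q = r" for y Q
    proof -
      obtain i where i: "ufd R i p" "uid (R, i) Q" "state D' y = nxt (state D x) R p i"
        using new[OF yQ(1,2)] by blast
      then have "eqv R i p \<and> Q \<in> cls (R, i)" using rank_between(2)[OF i(1,2)] x(2) yQ(3) by simp
      then show ?thesis using level_nxt[of Q R i p "state D x"] x(3) D(4) i(3) by simp
    qed
    have old_lack: "y \<in> lack D Q" if "y \<in> lack D' Q" "y \<in> elems D" for y Q using old[of Q] that by blast
    show ?thesis
    proof (rule that[OF D'(1)])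
      show "sat_below r D'" unfolding sat_below_def
      proof (intro allI impI)
        fix Q assume Q: "rank Q < r"
        have "y \<notin> lack D' Q" for y
          using old_lack[of y Q] new_rank[of y Q] Q sat_belowD[OF D(2) Q] by auto
        then show "lack D' Q = {}" by blast
      qed
      show "level_ge r d D'" unfolding level_ge_def
      proof (intro allI impI)
        fix Q y assume y: "rank Q = r" "y \<in> lack D' Q"
        show "d \<le> level (state D' y) Q"
        proof (cases "y \<in> elems D")
          case True
          then show ?thesis using level_geD[OF D(3) y(1) old_lack[OF y(2)]] D'(3) by simp
        next
          case False
          then show ?thesis using new_level[OF y(2) False y(1)] by simp
        qed
      qed
      show "{(y, Q). rank Q = r \<and> y \<in> lack D' Q \<and> level (state D' y) Q = d} \<subseteq>
       {(y, Q). rank Q = r \<and> y \<in> lack D Q \<and> level (state D y) Q = d} - {(x, R, p)}"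
      proof
        fix z assume "z \<in> {(y, Q). rank Q = r \<and> y \<in> lack D' Q \<and> level (state D' y) Q = d}"
        then obtain y Q where z: "z = (y, Q)" "rank Q = r" "y \<in> lack D' Q" "level (state D' y) Q = d"
          by blast
        have y: "y \<in> elems D" using new_level[OF z(3) _ z(2)] z(4) by auto
        have "z \<noteq> (x, R, p)" using old[of Q] y z(1,3) by (auto simp: c_def)
        then show "z \<in> {(y, Q). rank Q = r \<and> y \<in> lack D Q \<and> level (state D y) Q = d} - {(x, R, p)}"
          using z old_lack[OF z(3) y] D'(3)[OF y] by simp
      qed
    qed
  qed
qed

lemma finite_lack_pairs: "inv Bs D \<Longrightarrow> finite {(y, Q). y \<in> lack D Q}"
proof (rule finite_subset)
  assume "inv Bs D"
  then show "finite (elems D \<times> Pos \<sigma>)" using inv_finite finite_Pos[OF wf] by simp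
  show "{(y, Q). y \<in> lack D Q} \<subseteq> elems D \<times> Pos \<sigma>" using lackD lack_Pos by blast
qed

text \<open>The process ends because a step removes a lack of level \<open>d\<close> and creates
  none: whatever it creates at rank \<open>r\<close> has a higher level.\<close>

lemma ball_level:
  assumes "d < K"
  shows "inv Bs D \<Longrightarrow> sat_below r D \<Longrightarrow> level_ge r d D \<Longrightarrow>
    \<exists>D'. inv Bs D' \<and> sat_below r D' \<and> level_ge r (Suc d) D'"
proof (induction "card {(y, Q). rank Q = r \<and> y \<in> lack D Q \<and> level (state D y) Q = d}" arbitrary: D
    rule: less_induct)
  case less
  let ?B = "\<lambda>D. {(y, Q). rank Q = r \<and> y \<in> lack D Q \<and> level (state D y) Q = d}"
  show ?case
  proof (cases "?B D = {}")
    case True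
    then have "level_ge r (Suc d) D"
      using less.prems(3) unfolding level_ge_def by (auto simp: Suc_le_eq order_less_le)
    then show ?thesis using less.prems by blast
  next
    case False
    then obtain x R p where x: "x \<in> lack D (R, p)" "rank (R, p) = r" "level (state D x) (R, p) = d" by auto
    obtain D' where D': "inv Bs D'" "sat_below r D'" "level_ge r d D'" "?B D' \<subseteq> ?B D - {(x, R, p)}"
      using ball_step[OF less.prems assms x] by blast
    have "finite (?B D)" by (rule finite_subset[OF _ finite_lack_pairs[OF less.prems(1)]]) auto
    moreover have "?B D' \<subset> ?B D" using D'(4) x by blast
    ultimately have "card (?B D') < card (?B D)" by (rule psubset_card_mono)
    then show ?thesis using less.hyps D' by blast
  qed
qed

lemma ball:
  assumes "inv Bs D" "sat_below r D" "d \<le> K"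
  shows "\<exists>D'. inv Bs D' \<and> sat_below r D' \<and> level_ge r d D'"
  using assms(3)
proof (induction d)
  case 0
  then show ?case using assms by (auto simp: level_ge_def)
next
  case (Suc d)
  then show ?case using ball_level[of d] by (meson Suc_le_lessD Suc_leD)
qed

section \<open>Padding and closing at one rank\<close>

definition all_zrole :: "nat \<Rightarrow> ('r, 'a) pstruct \<Rightarrow> bool" where
  "all_zrole r D \<longleftrightarrow> (\<forall>Q x. rank Q = r \<longrightarrow> x \<in> lack D Q \<longrightarrow> zrole (state D x) Q)"

lemma all_zroleD: "all_zrole r D \<Longrightarrow> rank Q = r \<Longrightarrow> x \<in> lack D Q \<Longrightarrow> zrole (state D x) Q"
  unfolding all_zrole_def by blast

lemma level_K:
  assumes "inv Bs D" "level_ge r K D"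
  shows "all_zrole r D"
  unfolding all_zrole_def
proof (intro allI impI)
  fix Q x assume x: "rank Q = r" "x \<in> lack D Q"
  have "K \<le> level (state D x) Q" using level_geD[OF assms(2) x] .
  moreover have "run (state D x) < K" using inv_okst[OF assms(1)] lackD[OF x(2)] okst_run by blast
  ultimately show "zrole (state D x) Q" using K_pos by (auto simp: level_def split: if_splits)
qed

lemma add_Z:
  assumes D: "inv Bs D" and P: "P \<in> Pos \<sigma>" "reach (fst P)"
  obtains D' x where "inv Bs D'" "x \<notin> elems D" "state D' x = [EZ (cls P)]"
    "\<And>y. y \<in> elems D \<Longrightarrow> state D' y = state D y"
    "\<And>Q. need D' Q = (if uid P Q then insert x (need D Q) else need D Q)"
    "\<And>Q. lack D' Q = (if uid P Q then insert x (lack D Q) else lack D Q)"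
proof -
  obtain x where x: "x \<notin> elems D" using inv_finite[OF D] ex_new_if_finite infinite_UNIV_nat by blast
  define D' where "D' = D\<lparr>elems := insert x (elems D), state := (state D)(x := [EZ (cls P)])\<rparr>"
  have "inv Bs D'"
  proof (rule invI)
    show "finite (elems D')" "finite (facts D')" "Bs \<subseteq> facts D'"
      using inv_finite[OF D] inv_base[OF D] by (simp_all add: D'_def)
    show "okst (state D' y)" if "y \<in> elems D'" for y
      using that inv_okst[OF D] okst_Z[OF P] by (auto simp: D'_def)
    fix \<gamma> m assume "(\<gamma>, m) \<in> facts D'"
    then have f: "(\<gamma>, m) \<in> facts D" by (simp add: D'_def)
    show "okft \<gamma>" "dom m = dm \<gamma> \<or> (\<gamma>, m) \<in> Bs" using inv_fact[OF D f] by blast+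
    show "j \<in> dom m" if "i \<in> dom m" "eqv (rel \<gamma>) i j" for i j using inv_fact(3)[OF D f that] .
    show "i < ar \<gamma> \<and> y \<in> elems D' \<and> state D' y = ty \<gamma> i" if "m i = Some y" for i y
      using inv_fact(5)[OF D f that] x by (auto simp: D'_def)
  next
    fix m R xs assume "(Init R xs, m) \<in> facts D'"
    then show "m = initm xs" using inv_fact(4)[OF D] by (simp add: D'_def)
  next
    fix \<gamma> m \<gamma>' m' i y
    assume "(\<gamma>, m) \<in> facts D'" "(\<gamma>', m') \<in> facts D'" "rel \<gamma> = rel \<gamma>'" "m i = Some y" "m' i = Some y"
    then show "(\<gamma>, m) = (\<gamma>', m') \<or> (\<exists>R xs ys. \<gamma> = Init R xs \<and> \<gamma>' = Init R ys)"
      using inv_linear[OF D] by (simp add: D'_def)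
  qed
  moreover have need: "need D' Q = (if uid P Q then insert x (need D Q) else need D Q)" for Q
    using x up_cls[OF P(1)] by (auto simp: need_def D'_def simp del: up.simps)
  moreover have "x \<notin> occ D Q" for Q using occ_need[OF D, of Q] x by (auto simp: need_def)
  then have "lack D' Q = (if uid P Q then insert x (lack D Q) else lack D Q)" for Q
    unfolding lack_def need by (auto simp: occ_def D'_def)
  ultimately show ?thesis using x by (intro that[of D' x]) (auto simp: D'_def)
qed

lemma need_cls: "Q \<in> cls P \<Longrightarrow> need D Q = need D P"
  unfolding need_def cls_def using up_closed[of P _ Q] up_closed[of Q _ P] by blast

text \<open>At rank \<open>r\<close> an added element of class \<open>cls P\<close> is needed
  exactly at the positions of that class, which all have as many needs as \<open>P\<close>; so the
  bound \<open>N\<close> is never exceeded. Relations that are not reachable are left alone, as an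
  element added there could not be mapped into every model.\<close>

lemma padding:
  assumes "inv Bs D" "sat_below r D" "all_zrole r D"
    and "\<forall>Q \<in> Pos \<sigma>. rank Q = r \<longrightarrow> card (need D Q) \<le> N"
  shows "\<exists>D'. inv Bs D' \<and> sat_below r D' \<and> all_zrole r D' \<and>
    (\<forall>Q \<in> Pos \<sigma>. rank Q = r \<longrightarrow> reach (fst Q) \<longrightarrow> card (need D' Q) = N)"
  using assms
proof (induction "\<Sum>Q \<in> {Q \<in> Pos \<sigma>. rank Q = r}. N - card (need D Q)" arbitrary: D rule: less_induct)
  case less
  show ?case
  proof (cases "\<exists>P \<in> Pos \<sigma>. rank P = r \<and> reach (fst P) \<and> card (need D P) \<noteq> N")
    case True
    then obtain P where P: "P \<in> Pos \<sigma>" "rank P = r" "reach (fst P)" "card (need D P) < N"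
      using less.prems(4) by (meson le_neq_implies_less)
    show ?thesis
    proof (rule add_Z[OF less.prems(1) P(1,3)])
      fix D' x assume D': "inv Bs D'" "x \<notin> elems D" "state D' x = [EZ (cls P)]"
        "\<And>y. y \<in> elems D \<Longrightarrow> state D' y = state D y"
        and need: "\<And>Q. need D' Q = (if uid P Q then insert x (need D Q) else need D Q)"
        and lack: "\<And>Q. lack D' Q = (if uid P Q then insert x (lack D Q) else lack D Q)"
      have fin: "finite (need D Q)" "x \<notin> need D Q" for Q
        using inv_finite[OF less.prems(1)] D'(2) by (auto simp: need_def)
      have cls: "Q \<in> cls P" if "uid P Q" "rank Q = r" for Q
        using uid_reversible[of P Q] that P(2) by (simp add: cls_def)
      have card: "card (need D' Q) = (if uid P Q then Suc (card (need D Q)) else card (need D Q))" for Q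
        using need fin by simp
      have lt: "card (need D Q) < N" if "uid P Q" "rank Q = r" for Q
        using need_cls[OF cls[OF that]] P(4) by simp
      have le: "\<forall>Q \<in> Pos \<sigma>. rank Q = r \<longrightarrow> card (need D' Q) \<le> N"
        using card lt less.prems(4) by (simp add: Suc_le_eq)
      have "sat_below r D'" unfolding sat_below_def
      proof (intro allI impI)
        fix Q assume Q: "rank Q < r"
        have "lack D Q = {}" using sat_belowD[OF less.prems(2) Q] .
        then show "lack D' Q = {}" using Q lack[of Q] uid_rank[of P Q] P(2) by auto
      qed
      moreover have "all_zrole r D'" unfolding all_zrole_def
      proof (intro allI impI)
        fix Q y assume y: "rank Q = r" "y \<in> lack D' Q"
        show "zrole (state D' y) Q"
        proof (cases "y \<in> lack D Q")
          case True
          then show ?thesis using all_zroleD[OF less.prems(3) y(1) True] D'(4) lackD[OF True] by simp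
        next
          case False
          then have "y = x" "uid P Q" using y(2) lack[of Q] by (auto split: if_splits)
          then show ?thesis using cls y(1) D'(3) by (simp add: zrole_def)
        qed
      qed
      moreover have "(\<Sum>Q \<in> {Q \<in> Pos \<sigma>. rank Q = r}. N - card (need D' Q)) <
        (\<Sum>Q \<in> {Q \<in> Pos \<sigma>. rank Q = r}. N - card (need D Q))"
      proof (rule sum_strict_mono_ex1)
        show "finite {Q \<in> Pos \<sigma>. rank Q = r}" using finite_Pos[OF wf] by simp
        show "\<forall>Q \<in> {Q \<in> Pos \<sigma>. rank Q = r}. N - card (need D' Q) \<le> N - card (need D Q)"
          using card by (simp add: diff_le_mono2)
        show "\<exists>Q \<in> {Q \<in> Pos \<sigma>. rank Q = r}. N - card (need D' Q) < N - card (need D Q)"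
          using P card by (intro bexI[of _ P]) auto
      qed
      ultimately show ?thesis using less.hyps D'(1) le by blast
    qed
  qed (use less.prems in blast)
qed

lemma occ_fd:
  assumes D: "inv Bs D" and f: "(\<gamma>, m) \<in> facts D" "(\<gamma>', m') \<in> facts D" "rel \<gamma> = R" "rel \<gamma>' = R"
    and e: "eqv R i j" and x: "m i = Some x" "m' i = Some x"
  shows "m j = m' j"
proof -
  from inv_linear[OF D f(1,2) _ x] f(3,4)
  consider "(\<gamma>, m) = (\<gamma>', m')" | xs ys where "\<gamma> = Init R xs" "\<gamma>' = Init R ys" by auto
  then show ?thesis
  proof cases
    case 2
    have I: "(R, xs) \<in> I\<^sub>0" "(R, ys) \<in> I\<^sub>0"
      using inv_fact(1)[OF D f(1)] inv_fact(1)[OF D f(2)] 2 by simp_all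
    then have l: "length xs = arity \<sigma> R" "length ys = arity \<sigma> R" using inst by (auto simp: is_instance_def)
    have m: "m = initm xs" "m' = initm ys" using inv_fact(4)[OF D f(1) 2(1)] inv_fact(4)[OF D f(2) 2(2)] .
    have lt: "i < arity \<sigma> R" "j < arity \<sigma> R" using e ufd_Pos[of R i j] by (simp_all add: eqv_def Pos_iff)
    have "\<iota> (xs ! i) = \<iota> (ys ! i)" using x lt l m by (simp add: initm_def)
    moreover have "zs ! i \<in> (\<Union>(R, xs) \<in> I\<^sub>0. set xs)" if "(R, zs) \<in> I\<^sub>0" "length zs = arity \<sigma> R" for zs
      using that(1) nth_mem[of i zs] lt(1) that(2) by (intro UN_I[of "(R, zs)"]) simp_all
    ultimately have "xs ! i = ys ! i" using inj_onD[OF inj_\<iota>] I l by blast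
    moreover have "sat_dep I\<^sub>0 (FD R {i} j)" by (rule sat_I\<^sub>0) (use e in \<open>simp add: eqv_def ufd_def\<close>)
    ultimately have "xs ! j = ys ! j" using I unfolding sat_dep.simps by blast
    then show ?thesis using m l by (simp add: initm_def)
  qed simp
qed

lemma card_occ_le:
  assumes D: "inv Bs D" and e: "eqv R i j"
  shows "card (occ D (R, i)) \<le> card (occ D (R, j))"
proof -
  define g where "g x = (SOME y. \<exists>\<gamma> m. (\<gamma>, m) \<in> facts D \<and> rel \<gamma> = R \<and> m i = Some x \<and> m j = Some y)" for x
  have g: "\<exists>\<gamma> m. (\<gamma>, m) \<in> facts D \<and> rel \<gamma> = R \<and> m i = Some x \<and> m j = Some (g x)" if "x \<in> occ D (R, i)" for x
    unfolding g_def
  proof (rule someI_ex)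
    obtain \<gamma> m where f: "(\<gamma>, m) \<in> facts D" "rel \<gamma> = R" "m i = Some x" using \<open>x \<in> occ D (R, i)\<close> by (auto simp: occ_def)
    then have "j \<in> dom m" using inv_fact(3)[OF D f(1), of i j] e by blast
    then show "\<exists>y \<gamma> m. (\<gamma>, m) \<in> facts D \<and> rel \<gamma> = R \<and> m i = Some x \<and> m j = Some y" using f by blast
  qed
  show ?thesis
  proof (rule card_inj_on_le)
    show "inj_on g (occ D (R, i))"
    proof (rule inj_onI)
      fix x y assume xy: "x \<in> occ D (R, i)" "y \<in> occ D (R, i)" "g x = g y"
      obtain \<gamma> m where f: "(\<gamma>, m) \<in> facts D" "rel \<gamma> = R" "m i = Some x" "m j = Some (g x)" using g[OF xy(1)] by blast
      obtain \<gamma>' m' where f': "(\<gamma>', m') \<in> facts D" "rel \<gamma>' = R" "m' i = Some y" "m' j = Some (g y)" using g[OF xy(2)] by blast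
      have "m i = m' i" using occ_fd[OF D f(1) f'(1) f(2) f'(2) eqv_sym[OF e]] f(4) f'(4) xy(3) by simp
      then show "x = y" using f f' by simp
    qed
    show "g ` occ D (R, i) \<subseteq> occ D (R, j)"
    proof
      fix y assume "y \<in> g ` occ D (R, i)"
      then obtain x where "x \<in> occ D (R, i)" "y = g x" by blast
      then show "y \<in> occ D (R, j)" using g[of x] by (auto simp: occ_def)
    qed
    show "finite (occ D (R, j))"
      using occ_need[OF D] inv_finite[OF D] by (auto simp: need_def intro: finite_subset)
  qed
qed

definition balanced :: "nat \<Rightarrow> ('r, 'a) pstruct \<Rightarrow> bool" where
  "balanced r D \<longleftrightarrow> (\<forall>R i j. eqv R i j \<longrightarrow> rank (R, i) = r \<longrightarrow> card (lack D (R, i)) = card (lack D (R, j)))"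

lemma eqv_rank: "eqv R i j \<Longrightarrow> rank (R, i) = rank (R, j)"
  using ufd_rank[of R i j] ufd_rank[of R j i] by (simp add: eqv_def)

text \<open>Equivalent positions are occupied by equally many elements, since a fact occupies all or none
  of them.\<close>

lemma balancedI:
  assumes D: "inv Bs D" and N: "\<forall>Q \<in> Pos \<sigma>. rank Q = r \<longrightarrow> reach (fst Q) \<longrightarrow> card (need D Q) = N"
  shows "balanced r D"
  unfolding balanced_def
proof (intro allI impI)
  fix R i j assume e: "eqv R i j" and r: "rank (R, i) = r"
  have P: "(R, i) \<in> Pos \<sigma>" "(R, j) \<in> Pos \<sigma>" using e ufd_Pos[of R i j] by (simp_all add: eqv_def)
  have "card (need D (R, i)) = card (need D (R, j))"
  proof (cases "reach R")
    case True
    then show ?thesis using N P r eqv_rank[OF e] by simp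
  next
    case False
    have "need D (R, k) = {}" for k
      using inv_okst[OF D] okst_reach[of _ R k] False by (auto simp: need_def)
    then show ?thesis by simp
  qed
  moreover have "card (lack D Q) = card (need D Q) - card (occ D Q)" for Q
    unfolding lack_def using occ_need[OF D, of Q] inv_finite[OF D]
    by (intro card_Diff_subset) (auto simp: need_def intro: finite_subset)
  moreover have "card (occ D (R, i)) = card (occ D (R, j))"
    using card_occ_le[OF D e] card_occ_le[OF D eqv_sym[OF e]] by simp
  ultimately show "card (lack D (R, i)) = card (lack D (R, j))" by simp
qed

text \<open>Balance guarantees a lacking element at every position equivalent to \<open>p\<close>.
  The fact takes one from each, so the counts drop by one at all these positions alike and balance
  persists.\<close>

lemma closing_step:
  assumes D: "inv Bs D" "sat_below r D" "all_zrole r D" "balanced r D"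
    and x: "x \<in> lack D (R, p)" "rank (R, p) = r"
  obtains D' where "inv Bs D'" "sat_below r D'" "all_zrole r D'" "balanced r D'"
    "\<And>Q. rank Q = r \<Longrightarrow> card (lack D' Q) \<le> card (lack D Q)"
    "card (lack D' (R, p)) < card (lack D (R, p))"
proof -
  have Rp: "(R, p) \<in> Pos \<sigma>" using lack_Pos[OF x(1)] .
  have "reach R" using okst_reach[of "state D x" R p] lackD[OF x(1)] inv_okst[OF D(1)] by blast
  then have s: "okst [EZ (cls (R, p))]" "(R, p) \<in> up [EZ (cls (R, p))]"
    using okst_Z[of "(R, p)"] Rp up_cls by (simp_all del: up.simps)
  define c where "c i = (if eqv R i p then Some (SOME y. y \<in> lack D (R, i)) else None)" for i
  have some: "(SOME y. y \<in> lack D (R, i)) \<in> lack D (R, i)" if "eqv R i p" for i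
  proof -
    have "card (lack D (R, i)) = card (lack D (R, p))" using D(4) that x(2) eqv_rank[OF that] by (simp add: balanced_def)
    moreover have "card (lack D (R, p)) \<noteq> 0" using x finite_lack[OF D(1)] by auto
    ultimately have "lack D (R, i) \<noteq> {}" by auto
    then show ?thesis using some_in_eq by blast
  qed
  have c: "ufd R i p \<and> y \<in> lack D (R, i) \<and> state D y = ty (Cr [EZ (cls (R, p))] R p) i"
    if iy: "c i = Some y" for i y
  proof -
    have e: "eqv R i p" and y: "y \<in> lack D (R, i)" using iy some by (auto simp: c_def split: if_splits)
    have "zrole (state D y) (R, i)" using all_zroleD[OF D(3) _ y] eqv_rank[OF e] x(2) by simp
    then obtain d where d: "state D y = [EZ d]" "(R, i) \<in> d" unfolding zrole_def by blast
    moreover have "okst (state D y)" using inv_okst[OF D(1)] lackD[OF y] by blast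
    ultimately have "state D y = [EZ (cls (R, i))]" using okst_Z_cls by simp
    \<comment> \<open>By the first disjunct of \<open>forget\<close> the type prescribes
      \<open>[EZ (cls (R, i))]\<close> here, the very state of the elements that lack this
      position.\<close>
    moreover have "forget [EZ (cls (R, p))] R p i" using e Rp by (simp add: forget_def)
    ultimately show ?thesis using e y by (simp add: eqv_def nxt_def)
  qed
  have cp: "p \<in> dom c" using Rp by (simp add: c_def dom_def)
  show ?thesis
  proof (rule add_fact[OF D(1) s cp c])
    fix D' assume D': "inv Bs D'" "elems D \<subseteq> elems D'" "\<And>y. y \<in> elems D \<Longrightarrow> state D' y = state D y"
      and old: "\<And>Q. lack D' Q \<inter> elems D = lack D Q - {y. fst Q = R \<and> c (snd Q) = Some y}"
      and new: "\<And>Q y. y \<in> lack D' Q \<Longrightarrow> y \<notin> elems D \<Longrightarrow>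
         \<exists>i. ufd R i p \<and> c i = None \<and> uid (R, i) Q \<and> Q \<noteq> (R, i) \<and> state D' y = nxt [EZ (cls (R, p))] R p i"
    \<comment> \<open>Fresh elements arise only at positions not equivalent to \<open>p\<close>, so
      what they need lies strictly higher.\<close>
    have new_rank: "r < rank Q" if yQ: "y \<in> lack D' Q" "y \<notin> elems D" for y Q
    proof -
      obtain i where i: "ufd R i p" "c i = None" "uid (R, i) Q" using new[OF yQ] by blast
      have "\<not> eqv R i p" using i(2) by (auto simp: c_def)
      then show ?thesis using rank_between[OF i(1,3)] x(2) by fastforce
    qed
    have in_D: "y \<in> elems D" if "y \<in> lack D' Q" "rank Q \<le> r" for y Q
      using new_rank[of y Q] that by fastforce
    have lack: "lack D' Q = lack D Q - {y. fst Q = R \<and> c (snd Q) = Some y}" if "rank Q \<le> r" for Q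
      using old[of Q] in_D[OF _ that] by blast
    have card: "card (lack D' (S, i)) = (if S = R \<and> eqv R i p then card (lack D (S, i)) - 1 else card (lack D (S, i)))"
      if "rank (S, i) = r" for S i
    proof (cases "S = R \<and> eqv R i p")
      case True
      then have "lack D' (S, i) = lack D (S, i) - {SOME y. y \<in> lack D (R, i)}"
        using lack[of "(S, i)"] that by (auto simp: c_def)
      then show ?thesis using True some[of i] by simp
    next
      case False
      then have "lack D' (S, i) = lack D (S, i)" using lack[of "(S, i)"] that by (auto simp: c_def split: if_splits)
      then show ?thesis unfolding if_not_P[OF False] by simp
    qed
    show ?thesis
    proof (rule that[OF D'(1)])
      show "sat_below r D'" unfolding sat_below_def
      proof (intro allI impI)
        fix Q assume Q: "rank Q < r"
        then show "lack D' Q = {}" using lack[of Q] sat_belowD[OF D(2) Q] by simp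
      qed
      show "all_zrole r D'" unfolding all_zrole_def
      proof (intro allI impI)
        fix Q y assume y: "rank Q = r" "y \<in> lack D' Q"
        then have "y \<in> lack D Q" "y \<in> elems D" using lack[of Q] in_D[OF y(2)] by auto
        then show "zrole (state D' y) Q" using all_zroleD[OF D(3) y(1)] D'(3) by simp
      qed
      show "balanced r D'" unfolding balanced_def
      proof (intro allI impI)
        fix S i j assume e: "eqv S i j" "rank (S, i) = r"
        have "card (lack D (S, i)) = card (lack D (S, j))" using D(4) e by (simp add: balanced_def)
        moreover have "eqv S i p \<longleftrightarrow> eqv S j p" using e(1) eqv_trans eqv_sym by blast
        ultimately show "card (lack D' (S, i)) = card (lack D' (S, j))"
          using card[of S i] card[of S j] e eqv_rank[OF e(1)] by auto
      qed
      show "card (lack D' Q) \<le> card (lack D Q)" if "rank Q = r" for Q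
        using card[of "fst Q" "snd Q"] that by auto
      show "card (lack D' (R, p)) < card (lack D (R, p))"
      proof -
        have "card (lack D (R, p)) \<noteq> 0" using x finite_lack[OF D(1)] by auto
        then show ?thesis using card[of R p] x(2) Rp by simp
      qed
    qed
  qed
qed

lemma closing:
  assumes "inv Bs D" "sat_below r D" "all_zrole r D" "balanced r D"
  shows "\<exists>D'. inv Bs D' \<and> sat_below (Suc r) D'"
  using assms
proof (induction "\<Sum>Q \<in> {Q \<in> Pos \<sigma>. rank Q = r}. card (lack D Q)" arbitrary: D rule: less_induct)
  case less
  show ?case
  proof (cases "\<exists>Q. rank Q = r \<and> lack D Q \<noteq> {}")
    case True
    then obtain R p x where x: "x \<in> lack D (R, p)" "rank (R, p) = r" by (metis ex_in_conv surj_pair)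
    show ?thesis
    proof (rule closing_step[OF less.prems x])
      fix D' assume D': "inv Bs D'" "sat_below r D'" "all_zrole r D'" "balanced r D'"
        and le: "\<And>Q. rank Q = r \<Longrightarrow> card (lack D' Q) \<le> card (lack D Q)"
        and less': "card (lack D' (R, p)) < card (lack D (R, p))"
      have "(\<Sum>Q \<in> {Q \<in> Pos \<sigma>. rank Q = r}. card (lack D' Q)) <
        (\<Sum>Q \<in> {Q \<in> Pos \<sigma>. rank Q = r}. card (lack D Q))"
      proof (rule sum_strict_mono_ex1)
        show "finite {Q \<in> Pos \<sigma>. rank Q = r}" using finite_Pos[OF wf] by simp
        show "\<forall>Q \<in> {Q \<in> Pos \<sigma>. rank Q = r}. card (lack D' Q) \<le> card (lack D Q)" using le by blast
        show "\<exists>Q \<in> {Q \<in> Pos \<sigma>. rank Q = r}. card (lack D' Q) < card (lack D Q)"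
          using less' x lack_Pos[OF x(1)] by blast
      qed
      then show ?thesis using less.hyps D' by blast
    qed
  next
    case False
    then have "sat_below (Suc r) D"
      using sat_belowD[OF less.prems(2)] unfolding sat_below_def less_Suc_eq by blast
    then show ?thesis using less.prems(1) by blast
  qed
qed

lemma complete_rank:
  assumes "inv Bs D" "sat_below r D"
  shows "\<exists>D'. inv Bs D' \<and> sat_below (Suc r) D'"
proof -
  obtain D1 where D1: "inv Bs D1" "sat_below r D1" "level_ge r K D1" using ball[OF assms order_refl] by blast
  note z = level_K[OF D1(1,3)]
  \<comment> \<open>Any common bound on the needs would do as the target of the padding.\<close>
  have "\<forall>Q \<in> Pos \<sigma>. rank Q = r \<longrightarrow> card (need D1 Q) \<le> card (elems D1)"
    using inv_finite[OF D1(1)] by (auto simp: need_def intro: card_mono)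
  from padding[OF D1(1,2) z this] obtain D2 where D2: "inv Bs D2" "sat_below r D2" "all_zrole r D2"
    "\<forall>Q \<in> Pos \<sigma>. rank Q = r \<longrightarrow> reach (fst Q) \<longrightarrow> card (need D2 Q) = card (elems D1)" by blast
  then show ?thesis using closing balancedI by blast
qed

lemma completion:
  assumes "inv Bs D"
  shows "\<exists>D'. inv Bs D' \<and> (\<forall>Q. need D' Q \<subseteq> occ D' Q)"
proof -
  have "\<exists>D'. inv Bs D' \<and> sat_below r D'" for r
  proof (induction r)
    case 0
    then show ?case using assms by (auto simp: sat_below_def)
  next
    case (Suc r)
    then show ?case using complete_rank by blast
  qed
  then obtain D' where D': "inv Bs D'" "sat_below (Suc (card (Pos \<sigma>))) D'" by blast
  have "lack D' Q = {}" for Q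
  proof (rule sat_belowD[OF D'(2)])
    show "rank Q < Suc (card (Pos \<sigma>))"
      unfolding rank_def less_Suc_eq_le by (rule card_mono) (use finite_Pos[OF wf] in auto)
  qed
  then show ?thesis using D'(1) unfolding lack_def by blast
qed

end

section \<open>Avoiding short cycles\<close>

context fin_closed
begin

text \<open>Reduced words of bounded length, the last letter first. Letting a letter cancel itself, and
  do nothing when the word would become too long, turns it into an involution. The permutations
  of the words therefore act like a group without short relations between the letters.\<close>

definition letters :: "(('r, 'a) ftype \<times> nat) set" where
  "letters = {(\<gamma>, i). okft \<gamma> \<and> i < ar \<gamma> \<and> (\<exists>s R p. \<gamma> = Cr s R p)}"

definition words :: "(('r, 'a) ftype \<times> nat) list set" where
  "words = {w. set w \<subseteq> letters \<and> length w \<le> K \<and> distinct_adj w}"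

definition act :: "('r, 'a) ftype \<times> nat \<Rightarrow> (('r, 'a) ftype \<times> nat) list \<Rightarrow> (('r, 'a) ftype \<times> nat) list" where
  "act l w = (if w \<in> words \<and> l \<in> letters then
     if w \<noteq> [] \<and> hd w = l then tl w else if length w < K then l # w else w
   else w)"

text \<open>Initial facts have no letter and keep the permutation, so each permutation carries a
  complete copy of the initial instance. Its cycles may stay, since they exist in every
  model.\<close>

fun lab :: "('r, 'a) ftype \<Rightarrow> nat \<Rightarrow> ((('r, 'a) ftype \<times> nat) list \<Rightarrow> (('r, 'a) ftype \<times> nat) list) \<Rightarrow>
    (('r, 'a) ftype \<times> nat) list \<Rightarrow> (('r, 'a) ftype \<times> nat) list" where
  "lab (Init R xs) i g = g"
| "lab (Cr s R p) i g = act (Cr s R p, i) \<circ> g"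

lemma finite_letters: "finite letters"
proof (rule finite_subset)
  show "letters \<subseteq> (SIGMA \<gamma> : {\<gamma>. okft \<gamma>}. {..<ar \<gamma>})" by (auto simp: letters_def)
  show "finite (SIGMA \<gamma> : {\<gamma>. okft \<gamma>}. {..<ar \<gamma>})" using finite_okft by blast
qed

lemma finite_words: "finite words"
proof (rule finite_subset)
  show "words \<subseteq> {w. set w \<subseteq> letters \<and> length w \<le> K}" by (auto simp: words_def)
  show "finite {w. set w \<subseteq> letters \<and> length w \<le> K}" using finite_letters by (rule finite_lists_length_le)
qed

lemma Nil_words: "[] \<in> words"
  by (simp add: words_def)

lemma words_tl: "l # w \<in> words \<Longrightarrow> w \<in> words \<and> l \<in> letters \<and> length w < K \<and> (w = [] \<or> hd w \<noteq> l)"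
  by (cases w) (auto simp: words_def)

lemma words_Cons: "w \<in> words \<Longrightarrow> l \<in> letters \<Longrightarrow> length w < K \<Longrightarrow> w = [] \<or> hd w \<noteq> l \<Longrightarrow> l # w \<in> words"
  by (cases w) (auto simp: words_def)

lemma act_words: "w \<in> words \<Longrightarrow> act l w \<in> words"
proof (cases w)
  case (Cons l' v)
  then show "w \<in> words \<Longrightarrow> ?thesis" using words_tl[of l' v] words_Cons[of w l] by (auto simp: act_def)
next
  case Nil
  then show "w \<in> words \<Longrightarrow> ?thesis" using words_Cons[of w l] by (auto simp: act_def)
qed

lemma act_act: "act l (act l w) = w"
proof (cases "w \<in> words \<and> l \<in> letters")
  case True
  show ?thesis
  proof (cases "w \<noteq> [] \<and> hd w = l")
    case hd: True
    then have w: "w = l # tl w" by (cases w) auto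
    then have t: "tl w \<in> words" "length (tl w) < K" "tl w = [] \<or> hd (tl w) \<noteq> l"
      using words_tl[of l "tl w"] True by auto
    have "act l w = tl w" using True hd by (simp add: act_def)
    moreover have "act l (tl w) = l # tl w" using True t by (auto simp: act_def)
    ultimately show ?thesis using w by simp
  next
    case False
    show ?thesis
    proof (cases "length w < K")
      case len: True
      then have a: "act l w = l # w" using True False by (auto simp: act_def)
      have "l # w \<in> words" using words_Cons[of w l] True False len by auto
      then show ?thesis unfolding a using True by (simp add: act_def)
    next
      case len: False
      then have "act l w = w" using False by (auto simp: act_def)
      then show ?thesis by simp
    qed
  qed
next
  case False
  then have "act l w = w" by (auto simp: act_def)
  then show ?thesis by simp
qed

lemma act_permutes: "act l permutes words"
proof (rule bij_imp_permutes)
  show "bij_betw (act l) words words"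
    by (rule bij_betwI[where g = "act l"]) (use act_words act_act in auto)
  show "act l w = w" if "w \<notin> words" for w using that by (simp add: act_def)
qed

lemma lab_permutes: "g permutes words \<Longrightarrow> lab \<gamma> i g permutes words"
  using act_permutes by (cases \<gamma>) (auto intro: permutes_compose)

lemma lab_inj: "lab \<gamma> i g = lab \<gamma> i h \<Longrightarrow> g = h"
proof (cases \<gamma>)
  case (Cr s R p)
  assume "lab \<gamma> i g = lab \<gamma> i h"
  then have "act (\<gamma>, i) (g w) = act (\<gamma>, i) (h w)" for w using Cr by (auto dest: fun_cong)
  then show "g = h" using act_act by (metis ext)
qed simp

text \<open>This serves the UIDs: an element with any permutation must find a fact at each position
  where it is required. Conversely \<open>lab_inj\<close> serves the FDs, as an element recovers the
  permutation of a fact of known type.\<close>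

lemma lab_surj:
  assumes "h permutes words"
  obtains g where "g permutes words" "lab \<gamma> i g = h"
proof (cases \<gamma>)
  case (Init R xs)
  then show ?thesis using that assms by auto
next
  case (Cr s R p)
  have "act (\<gamma>, i) \<circ> h permutes words" using act_permutes assms by (auto intro: permutes_compose)
  moreover have "lab \<gamma> i (act (\<gamma>, i) \<circ> h) = h" using Cr act_act by (simp add: fun_eq_iff)
  ultimately show ?thesis by (rule that)
qed

lemma length_act: "length (act l w) \<le> Suc (length w)" "length w \<le> Suc (length (act l w))"
  by (auto simp: act_def)

section \<open>A homomorphism on the tree of words\<close>

definition dflt_st :: "('r, 'a) fact set \<Rightarrow> ('r, 'a) event list \<Rightarrow> 'a" where
  "dflt_st J s = (SOME y. hom_at J K s y)"

definition extend :: "('r, 'a) fact set \<Rightarrow> nat \<Rightarrow> ('r, 'a) ftype \<Rightarrow> nat \<Rightarrow> 'a \<Rightarrow> 'a list" where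
  "extend J n \<gamma> q y = (SOME ys. (rel \<gamma>, ys) \<in> J \<and> ys ! q = y \<and> (\<forall>i < ar \<gamma>. hom_at J n (ty \<gamma> i) (ys ! i)))"

fun dflt_ft :: "('r, 'a) fact set \<Rightarrow> ('r, 'a) ftype \<Rightarrow> 'a list" where
  "dflt_ft J (Init R xs) = xs"
| "dflt_ft J (Cr s R p) = extend J (K - 1) (Cr s R p) p (dflt_st J s)"

text \<open>At a word \<open>w\<close> the two components give the images of all elements and of all
  facts situated there. A fact of type \<open>\<gamma>\<close> and its element at \<open>i\<close>
  are one letter \<open>(\<gamma>, i)\<close> apart, in either direction. Hence an element at
  \<open>l # w\<close> that belongs to \<open>l\<close> is read off its fact at \<open>w\<close>, a
  fact at \<open>l # w\<close> of the type in \<open>l\<close> extends its element at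
  \<open>w\<close>, and everything else at \<open>l # w\<close> has no neighbour at \<open>w\<close>
  and gets a default.\<close>

primrec walk :: "('r, 'a) fact set \<Rightarrow> (('r, 'a) ftype \<times> nat) list \<Rightarrow>
    (('r, 'a) event list \<Rightarrow> 'a) \<times> (('r, 'a) ftype \<Rightarrow> 'a list)" where
  "walk J [] = (dflt_st J, dflt_ft J)"
| "walk J (l # w) =
    (\<lambda>b. if b = ty (fst l) (snd l) then snd (walk J w) (fst l) ! snd l else dflt_st J b,
     \<lambda>\<gamma>. if \<gamma> = fst l
       then extend J (K - Suc (length w)) \<gamma> (snd l) (fst (walk J w) (ty \<gamma> (snd l)))
       else dflt_ft J \<gamma>)"

lemma extend:
  assumes J: "model J" and \<gamma>: "okft (Cr s R p)" and q: "q < arity \<sigma> R" and n: "n < K"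
    and h: "hom_at J (Suc n) (ty (Cr s R p) q) y"
  shows "(R, extend J n (Cr s R p) q y) \<in> J" "extend J n (Cr s R p) q y ! q = y"
    "i < arity \<sigma> R \<Longrightarrow> hom_at J n (ty (Cr s R p) i) (extend J n (Cr s R p) q y ! i)"
proof -
  have "\<exists>ys. (R, ys) \<in> J \<and> ys ! q = y \<and> (\<forall>i < arity \<sigma> R. hom_at J n (ty (Cr s R p) i) (ys ! i))"
    using hom_at_extend[OF J _ _ q n h] \<gamma> by (metis okft.simps(2))
  from someI_ex[OF this]
  show "(R, extend J n (Cr s R p) q y) \<in> J" "extend J n (Cr s R p) q y ! q = y"
    "i < arity \<sigma> R \<Longrightarrow> hom_at J n (ty (Cr s R p) i) (extend J n (Cr s R p) q y ! i)"
    unfolding extend_def by auto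
qed

lemma dflt_st: "model J \<Longrightarrow> okst s \<Longrightarrow> hom_at J K s (dflt_st J s)"
  unfolding dflt_st_def using okst_hom_at by (blast intro: someI_ex)

lemma dflt_ft:
  assumes J: "model J" and \<gamma>: "okft (Cr s R p)"
  shows "(R, dflt_ft J (Cr s R p)) \<in> J"
    "i < arity \<sigma> R \<Longrightarrow> hom_at J (K - 1) (ty (Cr s R p) i) (dflt_ft J (Cr s R p) ! i)"
proof -
  have p: "p < arity \<sigma> R" using \<gamma> up_Pos[of "(R, p)" s] by (simp add: Pos_iff)
  have "hom_at J (Suc (K - 1)) (ty (Cr s R p) p) (dflt_st J s)" using dflt_st[OF J] \<gamma> K_pos by simp
  from extend[OF J \<gamma> p _ this] K_pos
  show "(R, dflt_ft J (Cr s R p)) \<in> J"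
    "i < arity \<sigma> R \<Longrightarrow> hom_at J (K - 1) (ty (Cr s R p) i) (dflt_ft J (Cr s R p) ! i)" by simp_all
qed

text \<open>Each letter uses up one event, by \<open>hom_at_extend\<close>: elements at
  \<open>w\<close> are matched for \<open>K - length w\<close> events, facts for one less. The last
  conjunct is the agreement of a fact with the element from which it was extended.\<close>

lemma walk:
  assumes J: "model J"
  shows "w \<in> words \<Longrightarrow>
    (\<forall>b. okst b \<longrightarrow> hom_at J (K - length w) b (fst (walk J w) b)) \<and>
    (\<forall>s R p. okft (Cr s R p) \<longrightarrow> length w < K \<longrightarrow> (R, snd (walk J w) (Cr s R p)) \<in> J \<and>
      (\<forall>i < arity \<sigma> R. hom_at J (K - Suc (length w)) (ty (Cr s R p) i) (snd (walk J w) (Cr s R p) ! i)) \<and>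
      (\<forall>i w'. w = (Cr s R p, i) # w' \<longrightarrow> snd (walk J w) (Cr s R p) ! i = fst (walk J w') (ty (Cr s R p) i)))"
proof (induction w)
  case Nil
  show ?case using dflt_st[OF J] dflt_ft[OF J] by simp
next
  case (Cons l w)
  note lw = words_tl[OF Cons.prems]
  obtain s0 R0 p0 i0 where l: "l = (Cr s0 R0 p0, i0)" and ok0: "okft (Cr s0 R0 p0)" and i0: "i0 < arity \<sigma> R0"
    using lw unfolding letters_def by auto
  note IH1 = conjunct1[OF Cons.IH[OF conjunct1[OF lw]], rule_format]
  note IH2 = conjunct2[OF Cons.IH[OF conjunct1[OF lw]], rule_format]
  have 1: "hom_at J (K - length (l # w)) b (fst (walk J (l # w)) b)" if b: "okst b" for b
  proof (cases "b = ty (Cr s0 R0 p0) i0")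
    case True
    then have "fst (walk J (l # w)) b = snd (walk J w) (Cr s0 R0 p0) ! i0" using l by simp
    then show ?thesis using IH2[OF ok0] i0 lw True by simp
  next
    case False
    then have "fst (walk J (l # w)) b = dflt_st J b" using l by simp
    then show ?thesis using hom_at_mono[OF dflt_st[OF J b]] by simp
  qed
  have 2: "(R, snd (walk J (l # w)) (Cr s R p)) \<in> J \<and>
      (\<forall>i < arity \<sigma> R. hom_at J (K - Suc (length (l # w))) (ty (Cr s R p) i) (snd (walk J (l # w)) (Cr s R p) ! i)) \<and>
      (\<forall>i w'. l # w = (Cr s R p, i) # w' \<longrightarrow> snd (walk J (l # w)) (Cr s R p) ! i = fst (walk J w') (ty (Cr s R p) i))"
    if ok: "okft (Cr s R p)" and len: "length (l # w) < K" for s R p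
  proof (cases "Cr s R p = Cr s0 R0 p0")
    case True
    let ?y = "fst (walk J w) (ty (Cr s R p) i0)" and ?n = "K - Suc (length w)"
    have e: "snd (walk J (l # w)) (Cr s R p) = extend J ?n (Cr s R p) i0 ?y" using l True by simp
    have "okst (ty (Cr s R p) i0)" using okft_ty(1)[OF ok] i0 True by simp
    from IH1[OF this] have "hom_at J (Suc ?n) (ty (Cr s R p) i0) ?y" using len by (simp add: Suc_diff_Suc)
    from extend[OF J ok _ _ this] i0 True len K_pos
    have x: "(R, extend J ?n (Cr s R p) i0 ?y) \<in> J" "extend J ?n (Cr s R p) i0 ?y ! i0 = ?y"
      "\<And>i. i < arity \<sigma> R \<Longrightarrow> hom_at J ?n (ty (Cr s R p) i) (extend J ?n (Cr s R p) i0 ?y ! i)"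
      by simp_all
    then show ?thesis unfolding e using hom_at_mono[OF x(3), of _ "K - Suc (length (l # w))"] l by auto
  next
    case False
    then have "snd (walk J (l # w)) (Cr s R p) = dflt_ft J (Cr s R p)" using l by auto
    then show ?thesis using dflt_ft[OF J ok] False l hom_at_mono[OF dflt_ft(2)[OF J ok], of _ "K - Suc (length (l # w))"] by auto
  qed
  show ?case using 1 2 by blast
qed

text \<open>If the letter is cancelled, the element is the one from which the fact was extended;
  otherwise it was read off the fact. The bound on \<open>length w\<close> excludes the case in
  which \<open>act\<close> leaves a full word unchanged.\<close>

lemma walk_act:
  assumes J: "model J" and w: "w \<in> words" "length w < K" and \<gamma>: "okft (Cr s R p)" and i: "i < arity \<sigma> R"
  shows "fst (walk J (act (Cr s R p, i) w)) (ty (Cr s R p) i) = snd (walk J w) (Cr s R p) ! i"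
proof -
  have l: "(Cr s R p, i) \<in> letters" using \<gamma> i by (simp add: letters_def)
  show ?thesis
  proof (cases "w \<noteq> [] \<and> hd w = (Cr s R p, i)")
    case True
    then have "w = (Cr s R p, i) # tl w" by (cases w) auto
    moreover have "act (Cr s R p, i) w = tl w" using True l w by (simp add: act_def)
    ultimately show ?thesis using walk[OF J w(1)] \<gamma> w(2) by metis
  next
    case False
    then have "act (Cr s R p, i) w = (Cr s R p, i) # w" using l w by (auto simp: act_def)
    then show ?thesis by simp
  qed
qed

definition typed :: "('r, 'a) fact set \<Rightarrow>
    ('a \<Rightarrow> ('r, 'a) event list \<times> ((('r, 'a) ftype \<times> nat) list \<Rightarrow> (('r, 'a) ftype \<times> nat) list)) \<Rightarrow> bool" where
  "typed I \<tau> \<longleftrightarrow> (\<forall>(R, xs) \<in> I. \<exists>\<gamma> g. okft \<gamma> \<and> rel \<gamma> = R \<and> g permutes words \<and> length xs = ar \<gamma> \<and>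
     (\<forall>i < ar \<gamma>. \<tau> (xs ! i) = (ty \<gamma> i, lab \<gamma> i g)))"

lemma relpow_rtrancl_bound:
  assumes "finite A" "r \<subseteq> A \<times> A" "(x, y) \<in> r\<^sup>*"
  shows "\<exists>n \<le> card A * card A. (x, y) \<in> r ^^ n"
proof -
  have fin: "finite r" using assms(1,2) finite_subset by blast
  then obtain n where "n \<le> card r" "(x, y) \<in> r ^^ n"
    using assms(3) rtrancl_finite_eq_relpow[OF fin] by auto
  moreover have "card r \<le> card A * card A"
    using card_mono[OF _ assms(2)] assms(1) by (simp add: card_cartesian_product)
  ultimately show ?thesis using le_trans by blast
qed

text \<open>A small connected set of facts of a typed instance is seen from one of its facts as a set of
  facts in the tree of words, which can be mapped into the model.\<close>

lemma typed_sat_cq: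
  assumes I: "typed I \<tau>" and J: "model J" and K: "2 * (k * k) < K"
    and q: "constant_free q" "length q \<le> k" "sat_cq I q"
  shows "sat_cq J q"
proof -
  obtain \<nu> where \<nu>: "\<And>R ts. (R, ts) \<in> set q \<Longrightarrow> (R, map (eval_term \<nu>) ts) \<in> I"
    using q(3) unfolding sat_cq_def by fast
  define A where "A = (\<lambda>(R, ts). (R, map (eval_term \<nu>) ts)) ` set q"
  have A: "A \<subseteq> I" using \<nu> unfolding A_def by auto
  have fin: "finite A" by (simp add: A_def)
  have "card A \<le> k" unfolding A_def using q(2) card_image_le[of "set q"] card_length[of q] by (meson List.finite_set le_trans)
  then have cardA: "card A * card A \<le> k * k" by (simp add: mult_le_mono)
  define ok where "ok f \<gamma> g \<longleftrightarrow> okft \<gamma> \<and> rel \<gamma> = fst f \<and> g permutes words \<and> length (snd f) = ar \<gamma> \<and>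
     (\<forall>i < ar \<gamma>. \<tau> (snd f ! i) = (ty \<gamma> i, lab \<gamma> i g))" for f \<gamma> g
  have "\<exists>\<gamma> g. ok f \<gamma> g" if "f \<in> A" for f
  proof -
    have "f \<in> I" using A that by blast
    then show ?thesis using bspec[OF I[unfolded typed_def], of f] unfolding ok_def by (cases f) simp
  qed
  then obtain \<Gamma> G where ok: "\<And>f. f \<in> A \<Longrightarrow> ok f (\<Gamma> f) (G f)" by metis
  have fact: "okft (\<Gamma> f)" "rel (\<Gamma> f) = fst f" "G f permutes words" "length (snd f) = ar (\<Gamma> f)"
    "i < ar (\<Gamma> f) \<Longrightarrow> \<tau> (snd f ! i) = (ty (\<Gamma> f) i, lab (\<Gamma> f) i (G f))" if "f \<in> A" for f i
    using ok[OF that] unfolding ok_def by blast+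
  define r where "r = {(f, f'). f \<in> A \<and> f' \<in> A \<and> set (snd f) \<inter> set (snd f') \<noteq> {}}"
  have "sym r" by (auto simp: r_def sym_def)
  then have sym: "sym (r\<^sup>*)" by (rule sym_rtrancl)
  define root where "root f = (SOME f'. (f, f') \<in> r\<^sup>*)" for f
  have root: "(f, root f) \<in> r\<^sup>*" for f unfolding root_def by (rule someI) (rule rtrancl_refl)
  have root_eq: "root f = root f'" if "(f, f') \<in> r" for f f'
  proof -
    have "(f, x) \<in> r\<^sup>* \<longleftrightarrow> (f', x) \<in> r\<^sup>*" for x
      using that sym \<open>sym r\<close> by (meson converse_rtrancl_into_rtrancl symE)
    then show ?thesis by (simp add: root_def)
  qed
  have root_root: "root (root f) = root f" for f
  proof -
    have "root x = root f" if "(f, x) \<in> r\<^sup>*" for x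
      using that
    proof (induction rule: rtrancl_induct)
      case (step y z)
      then show ?case using root_eq[OF step.hyps(2)] by simp
    qed simp
    then show ?thesis using root by blast
  qed
  have rootA: "root f \<in> A" if "f \<in> A" for f
    using root[of f] that by (induction rule: rtrancl_induct) (auto simp: r_def)
  \<comment> \<open>All permutations in a connected part are evaluated at one word, chosen so that
    the root fact comes to lie at the empty word.\<close>
  define start where "start f = inv_into UNIV (G (root f)) []" for f
  have start: "G (root f) (start f) = []" "start f \<in> words" if "f \<in> A" for f
  proof -
    note p = fact(3)[OF rootA[OF that]]
    show "G (root f) (start f) = []" unfolding start_def using permutes_surj[OF p] by (simp add: surj_f_inv_f)
    then show "start f \<in> words" using permutes_in_image[OF p, of "start f"] Nil_words by simp
  qed
  define word where "word f = G f (start f)" for f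
  have word: "word f \<in> words" if "f \<in> A" for f
    using permutes_in_image[OF fact(3)[OF that]] start(2)[OF that] by (simp add: word_def)
  have lab_word: "length (lab (\<Gamma> f) i (G f) (start f)) \<le> Suc (length (word f))"
    "length (word f) \<le> Suc (length (lab (\<Gamma> f) i (G f) (start f)))" for f i
    unfolding word_def using length_act by (cases "\<Gamma> f"; simp)+
  \<comment> \<open>One letter from a fact to the shared element, and one from there to the next
    fact.\<close>
  have step: "length (word f') \<le> length (word f) + 2" if r: "(f, f') \<in> r" for f f'
  proof -
    have f: "f \<in> A" "f' \<in> A" using r by (auto simp: r_def)
    obtain x where "x \<in> set (snd f)" "x \<in> set (snd f')" using r by (auto simp: r_def)
    then obtain i i' where i: "i < ar (\<Gamma> f)" "snd f ! i = x" "i' < ar (\<Gamma> f')" "snd f' ! i' = x"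
      using fact(4) f by (metis in_set_conv_nth)
    then have "lab (\<Gamma> f) i (G f) = lab (\<Gamma> f') i' (G f')"
      using fact(5)[OF f(1) i(1)] fact(5)[OF f(2) i(3)] by simp
    moreover have "start f = start f'" using root_eq[OF r] by (simp add: start_def)
    ultimately show ?thesis using lab_word(1)[of f i] lab_word(2)[of f' i'] by simp
  qed
  have short: "length (word f) < K" if f: "f \<in> A" for f
  proof -
    have "(root f, f) \<in> r\<^sup>*" using root[of f] sym by (rule symD[rotated])
    moreover have "r \<subseteq> A \<times> A" unfolding r_def by blast
    ultimately obtain n where n: "n \<le> card A * card A" "(root f, f) \<in> r ^^ n"
      using relpow_rtrancl_bound[OF fin] by blast
    have "length (word f') \<le> 2 * m" if "(root f, f') \<in> r ^^ m" for m f'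
      using that
    proof (induction m arbitrary: f')
      case 0
      then have "f' = root f" by simp
      then show ?case using start(1)[OF rootA[OF f]] root_root by (simp add: word_def)
    next
      case (Suc m)
      then obtain g where "(root f, g) \<in> r ^^ m" "(g, f') \<in> r" by auto
      then show ?case using Suc.IH[of g] step[of g f'] by simp
    qed
    from this[OF n(2)] show ?thesis using n(1) cardA K by simp
  qed
  \<comment> \<open>\<open>at x\<close> only tells in which connected part \<open>x\<close> lies:
    all facts that contain \<open>x\<close> have the same \<open>start\<close>.\<close>
  define at where "at x = (SOME f. f \<in> A \<and> x \<in> set (snd f))" for x
  have at: "start (at x) = start f" if "f \<in> A" "x \<in> set (snd f)" for f x
  proof -
    have "at x \<in> A \<and> x \<in> set (snd (at x))" unfolding at_def by (rule someI) (use that in blast)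
    then have "(at x, f) \<in> r" using that by (auto simp: r_def)
    then show ?thesis using root_eq by (simp add: start_def)
  qed
  define h where "h x = fst (walk J (snd (\<tau> x) (start (at x)))) (fst (\<tau> x))" for x
  have h: "h (xs ! i) = fst (walk J (lab (\<Gamma> (R, xs)) i (G (R, xs)) (start (R, xs)))) (ty (\<Gamma> (R, xs)) i)"
    if "(R, xs) \<in> A" "i < length xs" for R xs i
    using fact(4,5)[OF that(1)] at[OF that(1)] that(2) by (simp add: h_def)
  have hom: "(R, map h xs) \<in> J" if f: "(R, xs) \<in> A" for R xs
  proof (cases "\<Gamma> (R, xs)")
    case (Init S ys)
    then have S: "S = R" "(R, ys) \<in> I\<^sub>0" and len: "length xs = length ys"
      using fact(1,2,4)[OF f] inst by (auto simp: is_instance_def)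
    have "h (xs ! i) = ys ! i" if i: "i < length xs" for i
    proof -
      have "okst [EInit (ys ! i)]" using okst_Init[OF S(2)] i len by simp
      then have "hom_at J (K - length (word (R, xs))) [EInit (ys ! i)] (fst (walk J (word (R, xs))) [EInit (ys ! i)])"
        using walk[OF J word[OF f]] by blast
      moreover obtain n where "K - length (word (R, xs)) = Suc n"
        using short[OF f] by (metis Suc_diff_Suc)
      ultimately show ?thesis using h[OF f i] Init by (simp add: word_def)
    qed
    then have "map h xs = ys" using len by (simp add: list_eq_iff_nth_eq)
    then show ?thesis using S model_sub[OF J] by auto
  next
    case (Cr s S p)
    then have S: "S = R" and ok: "okft (Cr s R p)" and len: "length xs = arity \<sigma> R"
      using fact(1,2,4)[OF f] by auto
    let ?ys = "snd (walk J (word (R, xs))) (Cr s R p)"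
    have ys: "(R, ?ys) \<in> J" using walk[OF J word[OF f]] ok short[OF f] by blast
    have "h (xs ! i) = ?ys ! i" if i: "i < length xs" for i
      using h[OF f i] walk_act[OF J word[OF f] short[OF f] ok] i len Cr S by (simp add: word_def)
    then have "map h xs = ?ys" using len model_inst[OF J ys] by (simp add: list_eq_iff_nth_eq)
    then show ?thesis using ys by simp
  qed
  have "(R, map (eval_term (h \<circ> \<nu>)) ts) \<in> J" if a: "(R, ts) \<in> set q" for R ts
  proof -
    have "eval_term (h \<circ> \<nu>) t = h (eval_term \<nu> t)" if "t \<in> set ts" for t
      using q(1) a that unfolding constant_free_def by (cases t) auto
    then have "map (eval_term (h \<circ> \<nu>)) ts = map h (map (eval_term \<nu>) ts)" by simp
    moreover have "(R, map (eval_term \<nu>) ts) \<in> A" using a by (force simp: A_def)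
    ultimately show ?thesis using hom by metis
  qed
  then show ?thesis unfolding sat_cq_def by fast
qed

end

section \<open>Gluing\<close>

type_synonym ('r, 'a) key = "(('r, 'a) ftype \<times> nat set) option"

type_synonym ('r, 'a) word = "(('r, 'a) ftype \<times> nat) list"

type_synonym ('r, 'a) node = "('r, 'a) key \<times> (nat \<Rightarrow> nat) \<times> nat \<times> (('r, 'a) word \<Rightarrow> ('r, 'a) word)"

context pstruct_base
begin

definition adom :: "'a set" where
  "adom = (\<Union>(R, xs) \<in> I\<^sub>0. set xs)"

definition sock :: "('r, 'a) ftype \<Rightarrow> nat set" where
  "sock \<gamma> = {..<ar \<gamma>} - dm \<gamma>"

definition eqc :: "'r \<Rightarrow> nat \<Rightarrow> nat set" where
  "eqc R i = {j. eqv R i j}"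

definition key :: "('r, 'a) ftype \<Rightarrow> nat \<Rightarrow> ('r, 'a) key" where
  "key \<gamma> i = Some (\<gamma>, eqc (rel \<gamma>) i)"

definition keys :: "('r, 'a) key set" where
  "keys = insert None {key \<gamma> i | \<gamma> i. okft \<gamma> \<and> i \<in> sock \<gamma>}"

text \<open>The unit with key \<open>None\<close> contains the initial instance. The other units start from the
  elements at a class of equivalent positions that a fact of type \<open>\<gamma>\<close> shares with other facts.\<close>

fun base :: "('r, 'a) key \<Rightarrow> (('r, 'a) ftype \<times> (nat \<rightharpoonup> nat)) set" where
  "base None = (\<lambda>(R, xs). (Init R xs, initm xs)) ` I\<^sub>0"
| "base (Some (\<gamma>, \<phi>)) = {(\<gamma>, \<lambda>i. if i \<in> \<phi> then Some i else None)}"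

definition unit_of :: "('r, 'a) key \<Rightarrow> ('r, 'a) pstruct" where
  "unit_of u = (SOME D. inv (base u) D \<and> (\<forall>Q. need D Q \<subseteq> occ D Q))"

lemma I\<^sub>0_length: "(R, xs) \<in> I\<^sub>0 \<Longrightarrow> length xs = arity \<sigma> R"
  using inst by (auto simp: is_instance_def)

lemma I\<^sub>0_adom: "(R, xs) \<in> I\<^sub>0 \<Longrightarrow> i < arity \<sigma> R \<Longrightarrow> xs ! i \<in> adom"
  unfolding adom_def using I\<^sub>0_length[of R xs] by (intro UN_I[of "(R, xs)"]) auto

lemma dom_initm: "(R, xs) \<in> I\<^sub>0 \<Longrightarrow> dom (initm xs) = {..<arity \<sigma> R}"
  using I\<^sub>0_length[of R xs] by (auto simp: initm_def dom_def)

lemma finite_adom: "finite adom"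
  unfolding adom_def using fin_I\<^sub>0 by auto

lemma \<iota>_eq: "a \<in> adom \<Longrightarrow> b \<in> adom \<Longrightarrow> \<iota> a = \<iota> b \<longleftrightarrow> a = b"
  using inj_\<iota> unfolding adom_def by (rule inj_on_eq_iff)

lemma inv_initial:
  "inv (base None) \<lparr>elems = \<iota> ` adom, state = (\<lambda>x. [EInit (inv_into adom \<iota> x)]), facts = base None\<rparr>"
    (is "inv _ ?D")
proof (rule invI)
  show "finite (elems ?D)" "finite (facts ?D)" "base None \<subseteq> facts ?D"
    using finite_adom fin_I\<^sub>0 by simp_all
  have inv: "inv_into adom \<iota> (\<iota> a) = a" if "a \<in> adom" for a
    using that inj_\<iota> unfolding adom_def by (rule inv_into_f_f[rotated])
  show "okst (state ?D x)" if x: "x \<in> elems ?D" for x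
  proof -
    obtain a where a: "x = \<iota> a" "a \<in> adom" using x by auto
    then obtain R xs where "(R, xs) \<in> I\<^sub>0" "a \<in> set xs" unfolding adom_def by auto
    then have "okst [EInit a]" by (rule okst_Init)
    then show ?thesis using a inv by simp
  qed
  fix \<gamma> m assume "(\<gamma>, m) \<in> facts ?D"
  then obtain R xs where f: "\<gamma> = Init R xs" "m = initm xs" "(R, xs) \<in> I\<^sub>0" by auto
  show "okft \<gamma>" "dom m = dm \<gamma> \<or> (\<gamma>, m) \<in> base None" using f dom_initm by simp_all
  show "i < ar \<gamma> \<and> x \<in> elems ?D \<and> state ?D x = ty \<gamma> i" if "m i = Some x" for i x
  proof -
    have i: "i < arity \<sigma> R" "x = \<iota> (xs ! i)"
      using that f I\<^sub>0_length by (auto simp: initm_def split: if_splits)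
    then show ?thesis using I\<^sub>0_adom[OF f(3)] inv f by simp
  qed
  show "j \<in> dom m" if "i \<in> dom m" "eqv (rel \<gamma>) i j" for i j
    using ufd_Pos[of R i j] that f dom_initm[OF f(3)] by (simp add: eqv_def Pos_iff)
next
  fix m R xs assume "(Init R xs, m) \<in> facts ?D"
  then show "m = initm xs" by auto
next
  fix \<gamma> m \<gamma>' m' i x
  assume "(\<gamma>, m) \<in> facts ?D" "(\<gamma>', m') \<in> facts ?D" "rel \<gamma> = rel \<gamma>'"
  then show "(\<gamma>, m) = (\<gamma>', m') \<or> (\<exists>R xs ys. \<gamma> = Init R xs \<and> \<gamma>' = Init R ys)" by auto
qed

lemma sock_Cr: "i \<in> sock \<gamma> \<Longrightarrow> \<exists>s R p. \<gamma> = Cr s R p"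
  by (cases \<gamma>) (auto simp: sock_def)

lemma sock_eqv:
  assumes "i \<in> sock \<gamma>" "eqv (rel \<gamma>) i j"
  shows "j \<in> sock \<gamma>"
proof -
  obtain s R p where \<gamma>: "\<gamma> = Cr s R p" using sock_Cr[OF assms(1)] by blast
  have "j < arity \<sigma> R" using assms(2) \<gamma> ufd_Pos[of R i j] by (simp add: eqv_def Pos_iff)
  moreover have "\<not> ufd R j p" using assms \<gamma> ufd_trans[of R i j p] by (auto simp: sock_def eqv_def)
  ultimately show ?thesis using \<gamma> by (simp add: sock_def)
qed

lemma sock_Pos: "okft \<gamma> \<Longrightarrow> i \<in> sock \<gamma> \<Longrightarrow> (rel \<gamma>, i) \<in> Pos \<sigma>"
  using okft_rel by (simp add: Pos_iff sock_def)

lemma eqc_eq: "eqv R i j \<Longrightarrow> eqc R i = eqc R j"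
  unfolding eqc_def using eqv_trans eqv_sym by blast

lemma inv_socket:
  assumes "okft \<gamma>" "i \<in> sock \<gamma>"
  shows "inv (base (key \<gamma> i)) \<lparr>elems = eqc (rel \<gamma>) i, state = ty \<gamma>, facts = base (key \<gamma> i)\<rparr>"
    (is "inv _ ?D")
proof (rule invI)
  let ?m = "\<lambda>j. if j \<in> eqc (rel \<gamma>) i then Some j else None"
  have lt: "j < ar \<gamma>" if "j \<in> eqc (rel \<gamma>) i" for j
    using sock_eqv[OF assms(2)] that by (simp add: eqc_def sock_def)
  then have "eqc (rel \<gamma>) i \<subseteq> {..<ar \<gamma>}" by blast
  then show "finite (elems ?D)" using finite_subset by auto
  show "finite (facts ?D)" "base (key \<gamma> i) \<subseteq> facts ?D" by (simp_all add: key_def)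
  show "okst (state ?D j)" if "j \<in> elems ?D" for j
    using okft_ty(1)[OF assms(1) lt] that by simp
  fix \<delta> m assume "(\<delta>, m) \<in> facts ?D"
  then have f: "\<delta> = \<gamma>" "m = ?m" by (simp_all add: key_def)
  show "okft \<delta>" "dom m = dm \<delta> \<or> (\<delta>, m) \<in> base (key \<gamma> i)" using f assms by (simp_all add: key_def)
  show "j < ar \<delta> \<and> x \<in> elems ?D \<and> state ?D x = ty \<delta> j" if "m j = Some x" for j x
    using that f lt by (auto split: if_splits)
  have dom: "dom ?m = eqc (rel \<gamma>) i" by (auto simp: dom_def)
  show "l \<in> dom m" if "j \<in> dom m" "eqv (rel \<delta>) j l" for j l
    using that eqv_trans[of "rel \<gamma>" i j l] unfolding f dom by (simp add: eqc_def)
next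
  fix m R xs assume "(Init R xs, m) \<in> facts ?D"
  then show "m = initm xs" using sock_Cr[OF assms(2)] by (auto simp: key_def)
next
  fix \<delta> m \<delta>' m' j x
  assume "(\<delta>, m) \<in> facts ?D" "(\<delta>', m') \<in> facts ?D"
  then show "(\<delta>, m) = (\<delta>', m') \<or> (\<exists>R xs ys. \<delta> = Init R xs \<and> \<delta>' = Init R ys)" by (simp add: key_def)
qed

lemma unit_of:
  assumes "u \<in> keys"
  shows "inv (base u) (unit_of u)" "need (unit_of u) Q \<subseteq> occ (unit_of u) Q"
proof -
  have "\<exists>D. inv (base u) D"
    using assms inv_initial inv_socket unfolding keys_def by blast
  then have "\<exists>D. inv (base u) D \<and> (\<forall>Q. need D Q \<subseteq> occ D Q)" using completion by blast
  from someI_ex[OF this]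
  show "inv (base u) (unit_of u)" "need (unit_of u) Q \<subseteq> occ (unit_of u) Q"
    unfolding unit_of_def by blast+
qed

lemma finite_keys: "finite keys"
proof -
  have "{key \<gamma> i | \<gamma> i. okft \<gamma> \<and> i \<in> sock \<gamma>} \<subseteq> (\<lambda>(\<gamma>, i). key \<gamma> i) ` (SIGMA \<gamma> : {\<gamma>. okft \<gamma>}. {..<ar \<gamma>})"
    by (auto simp: sock_def)
  moreover have "finite (SIGMA \<gamma> : {\<gamma>. okft \<gamma>}. {..<ar \<gamma>})" using finite_okft by blast
  ultimately show ?thesis unfolding keys_def by (meson finite_imageI finite_insert finite_subset)
qed

text \<open>Every fact receives its own vector of \<open>dimn\<close> coordinates, and an element shared at the
  positions \<open>\<phi>\<close> remembers those in \<open>seen\<close>. It misses at least one coordinate, hence there are enough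
  vectors for all facts of all copies of the units when \<open>base_size\<close> is large.\<close>

definition dimn :: nat where
  "dimn = Suc (\<Sum>R \<in> rels \<sigma>. arity \<sigma> R)"

fun seen :: "('r, 'a) key \<Rightarrow> nat set" where
  "seen None = {}"
| "seen (Some (\<gamma>, \<phi>)) = {a. a < dimn \<and> \<not> (a \<in> sock \<gamma> \<and> (\<exists>i \<in> \<phi>. ufd (rel \<gamma>) a i))}"

definition base_size :: nat where
  "base_size = Suc (\<Sum>u \<in> keys. card (facts (unit_of u)))"

definition vects :: "nat set \<Rightarrow> (nat \<Rightarrow> nat) set" where
  "vects S = S \<rightarrow>\<^sub>E {..<base_size}"

definition indices :: "(('r, 'a) key \<times> (nat \<Rightarrow> nat) \<times> ('r, 'a) ftype \<times> (nat \<rightharpoonup> nat)) set" where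
  "indices = (SIGMA u : keys. vects (seen u) \<times> facts (unit_of u))"

definition vec :: "('r, 'a) key \<times> (nat \<Rightarrow> nat) \<times> ('r, 'a) ftype \<times> (nat \<rightharpoonup> nat) \<Rightarrow> nat \<Rightarrow> nat" where
  "vec = (SOME w. w ` indices \<subseteq> vects {..<dimn} \<and> inj_on w indices)"

lemma seen_less: "a \<in> seen u \<Longrightarrow> a < dimn"
  by (cases u) auto

lemma seen_card:
  assumes "u \<in> keys"
  shows "finite (seen u)" "card (seen u) \<le> dimn - 1"
proof -
  have sub: "seen u \<subseteq> {..<dimn}" using seen_less by blast
  then show fin: "finite (seen u)" using finite_subset by blast
  show "card (seen u) \<le> dimn - 1"
  proof (cases u)
    case None
    then show ?thesis by simp
  next
    case (Some z)
    then obtain \<gamma> i where u: "u = key \<gamma> i" "okft \<gamma>" "i \<in> sock \<gamma>" using assms unfolding keys_def by auto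
    have P: "(rel \<gamma>, i) \<in> Pos \<sigma>" using sock_Pos u by blast
    have "arity \<sigma> (rel \<gamma>) \<le> (\<Sum>R \<in> rels \<sigma>. arity \<sigma> R)"
      using wf P by (intro member_le_sum) (auto simp: wf_schema_def Pos_iff)
    then have "i < dimn" using P by (simp add: dimn_def Pos_iff)
    moreover have "eqv (rel \<gamma>) i i" "ufd (rel \<gamma>) i i" using P by simp_all
    \<comment> \<open>The missing coordinate is \<open>i\<close> itself, since \<open>i\<close>
      determines itself.\<close>
    then have "i \<notin> seen u" using u by (auto simp: key_def eqc_def)
    ultimately have "seen u \<subset> {..<dimn}" using sub by blast
    then have "card (seen u) < card {..<dimn}" by (intro psubset_card_mono) auto
    then show ?thesis by simp
  qed
qed

lemma finite_vects: "finite S \<Longrightarrow> finite (vects S)"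
  unfolding vects_def by (intro finite_PiE) auto

lemma card_vects: "finite S \<Longrightarrow> card (vects S) = base_size ^ card S"
  unfolding vects_def by (simp add: card_PiE)

lemma finite_indices: "finite indices"
  unfolding indices_def
  using finite_keys seen_card(1) finite_vects unit_of(1) inv_finite by (intro finite_SigmaI) blast+

text \<open>At most \<open>base_size ^ (dimn - 1)\<close> copies of each unit, times fewer than
  \<open>base_size\<close> facts in all units together, do not exceed the
  \<open>base_size ^ dimn\<close> vectors.\<close>

lemma card_indices: "card indices \<le> card (vects {..<dimn})"
proof -
  have "card indices = (\<Sum>u \<in> keys. card (vects (seen u) \<times> facts (unit_of u)))"
    unfolding indices_def using finite_keys seen_card(1) finite_vects unit_of(1) inv_finite
    by (intro card_SigmaI) blast+
  also have "\<dots> \<le> (\<Sum>u \<in> keys. base_size ^ (dimn - 1) * card (facts (unit_of u)))"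
  proof (rule sum_mono)
    fix u assume u: "u \<in> keys"
    have "base_size ^ card (seen u) \<le> base_size ^ (dimn - 1)"
      using seen_card(2)[OF u] by (intro power_increasing) (auto simp: base_size_def)
    then show "card (vects (seen u) \<times> facts (unit_of u)) \<le> base_size ^ (dimn - 1) * card (facts (unit_of u))"
      using card_vects[OF seen_card(1)[OF u]] by (simp add: card_cartesian_product)
  qed
  also have "\<dots> = base_size ^ (dimn - 1) * (\<Sum>u \<in> keys. card (facts (unit_of u)))"
    by (simp add: sum_distrib_left)
  also have "\<dots> \<le> base_size ^ (dimn - 1) * base_size"
    by (intro mult_le_mono) (auto simp: base_size_def)
  also have "\<dots> = card (vects {..<dimn})"
    by (simp add: card_vects dimn_def)
  finally show ?thesis .
qed

lemma vec: "t \<in> indices \<Longrightarrow> vec t \<in> vects {..<dimn}" "inj_on vec indices"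
proof -
  have "\<exists>w. w ` indices \<subseteq> vects {..<dimn} \<and> inj_on w indices"
    using card_le_inj[OF finite_indices finite_vects card_indices] by simp
  from someI_ex[OF this] have "vec ` indices \<subseteq> vects {..<dimn} \<and> inj_on vec indices"
    unfolding vec_def .
  then show "t \<in> indices \<Longrightarrow> vec t \<in> vects {..<dimn}" "inj_on vec indices" by auto
qed

section \<open>The glued instance\<close>

text \<open>The base fact of a unit other than \<open>None\<close> is a stand-in for a fact of some
  unit that takes elements from this one, and is not counted again. Initial facts are real.\<close>

definition active :: "('r, 'a) key \<Rightarrow> (('r, 'a) ftype \<times> (nat \<rightharpoonup> nat)) set" where
  "active u = (if u = None then facts (unit_of u) else facts (unit_of u) - base u)"

definition share :: "('r, 'a) key \<times> (nat \<Rightarrow> nat) \<times> ('r, 'a) ftype \<times> (nat \<rightharpoonup> nat) \<Rightarrow> nat \<Rightarrow> nat \<Rightarrow> nat" where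
  "share t i = (case t of (u, e, \<gamma>, m) \<Rightarrow> restrict (vec t) (seen (key \<gamma> i)))"

inductive live :: "('r, 'a) key \<Rightarrow> (nat \<Rightarrow> nat) \<Rightarrow> bool" where
  live_None: "live None (\<lambda>_. undefined)"
| live_share: "live u e \<Longrightarrow> (\<gamma>, m) \<in> active u \<Longrightarrow> i \<in> sock \<gamma> \<Longrightarrow> live (key \<gamma> i) (share (u, e, \<gamma>, m) i)"

lemma active_facts: "(\<gamma>, m) \<in> active u \<Longrightarrow> (\<gamma>, m) \<in> facts (unit_of u)"
  by (simp add: active_def split: if_splits)

lemma active_okft: "u \<in> keys \<Longrightarrow> (\<gamma>, m) \<in> active u \<Longrightarrow> okft \<gamma>"
  using inv_fact(1)[OF unit_of(1)] active_facts by blast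

lemma active_dom:
  assumes "u \<in> keys" "(\<gamma>, m) \<in> active u"
  shows "dom m = dm \<gamma>"
proof (cases "(\<gamma>, m) \<in> base u")
  case True
  then have "u = None" using assms(2) by (auto simp: active_def split: if_splits)
  then obtain R xs where "\<gamma> = Init R xs" "m = initm xs" "(R, xs) \<in> I\<^sub>0" using True by auto
  then show ?thesis using dom_initm by simp
next
  case False
  then show ?thesis using inv_fact(2)[OF unit_of(1)[OF assms(1)] active_facts[OF assms(2)]] by blast
qed

lemma vects_restrict: "w \<in> vects T \<Longrightarrow> S \<subseteq> T \<Longrightarrow> restrict w S \<in> vects S"
  unfolding vects_def by (rule restrict_PiE_iff[THEN iffD2]) (auto simp: PiE_iff)

lemma live_keys: "live u e \<Longrightarrow> u \<in> keys \<and> e \<in> vects (seen u)"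
proof (induction rule: live.induct)
  case live_None
  then show ?case by (simp add: keys_def vects_def)
next
  case (live_share u e \<gamma> m i)
  then have "(u, e, \<gamma>, m) \<in> indices" using active_facts by (simp add: indices_def)
  moreover have "seen (key \<gamma> i) \<subseteq> {..<dimn}" using seen_less by blast
  ultimately have "share (u, e, \<gamma>, m) i \<in> vects (seen (key \<gamma> i))"
    unfolding share_def prod.case by (intro vects_restrict[OF vec(1)])
  moreover have "key \<gamma> i \<in> keys" using active_okft live_share unfolding keys_def by blast
  ultimately show ?case by blast
qed

lemma active_index: "live u e \<Longrightarrow> (\<gamma>, m) \<in> active u \<Longrightarrow> (u, e, \<gamma>, m) \<in> indices"
  using live_keys active_facts by (simp add: indices_def)

text \<open>An open position \<open>i\<close> receives element \<open>i\<close> of the unit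
  \<open>key \<gamma> i\<close>, in the copy selected by \<open>share\<close>. Equivalent positions
  have the same key and select the same copy.\<close>

definition el :: "('r, 'a) key \<Rightarrow> (nat \<Rightarrow> nat) \<Rightarrow> ('r, 'a) ftype \<Rightarrow> (nat \<rightharpoonup> nat) \<Rightarrow>
    (('r, 'a) word \<Rightarrow> ('r, 'a) word) \<Rightarrow> nat \<Rightarrow> ('r, 'a) node" where
  "el u e \<gamma> m g i = (case m i of
     Some x \<Rightarrow> (u, e, x, lab \<gamma> i g)
   | None \<Rightarrow> (key \<gamma> i, share (u, e, \<gamma>, m) i, i, lab \<gamma> i g))"

definition glued_at :: "'r \<Rightarrow> ('r, 'a) node list \<Rightarrow>
    ('r, 'a) key \<Rightarrow> (nat \<Rightarrow> nat) \<Rightarrow> ('r, 'a) ftype \<Rightarrow> (nat \<rightharpoonup> nat) \<Rightarrow> (('r, 'a) word \<Rightarrow> ('r, 'a) word) \<Rightarrow> bool" where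
  "glued_at R xs u e \<gamma> m g \<longleftrightarrow> live u e \<and> (\<gamma>, m) \<in> active u \<and> g permutes words \<and>
     R = rel \<gamma> \<and> xs = map (el u e \<gamma> m g) [0..<ar \<gamma>]"

definition glued :: "('r, ('r, 'a) node) fact set" where
  "glued = {(R, xs). \<exists>u e \<gamma> m g. glued_at R xs u e \<gamma> m g}"

definition node_type :: "('r, 'a) node \<Rightarrow> ('r, 'a) event list \<times> (('r, 'a) word \<Rightarrow> ('r, 'a) word)" where
  "node_type X = (case X of (u, e, x, h) \<Rightarrow> (state (unit_of u) x, h))"

lemma finite_glued: "finite glued"
proof (rule finite_subset)
  let ?f = "\<lambda>((u, e, \<gamma>, m), g). (rel \<gamma>, map (el u e \<gamma> m g) [0..<ar \<gamma>])"
  show "glued \<subseteq> ?f ` (indices \<times> {g. g permutes words})"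
  proof
    fix z assume "z \<in> glued"
    then obtain u e \<gamma> m g where z: "z = (rel \<gamma>, map (el u e \<gamma> m g) [0..<ar \<gamma>])" "live u e" "(\<gamma>, m) \<in> active u" "g permutes words"
      unfolding glued_def glued_at_def by auto
    then have "((u, e, \<gamma>, m), g) \<in> indices \<times> {g. g permutes words}" using active_index by simp
    then show "z \<in> ?f ` (indices \<times> {g. g permutes words})" by (rule rev_image_eqI) (simp add: z(1))
  qed
  show "finite (?f ` (indices \<times> {g. g permutes words}))"
    using finite_indices finite_permutations[OF finite_words] by simp
qed

lemma sock_iff: "u \<in> keys \<Longrightarrow> (\<gamma>, m) \<in> active u \<Longrightarrow> i < ar \<gamma> \<Longrightarrow> i \<in> sock \<gamma> \<longleftrightarrow> m i = None"
  using active_dom[of u \<gamma> m] by (auto simp: sock_def)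

lemma key_root:
  assumes "okft \<gamma>" "i \<in> sock \<gamma>"
  obtains m where "base (key \<gamma> i) = {(\<gamma>, m)}" "(\<gamma>, m) \<in> facts (unit_of (key \<gamma> i))" "m i = Some i"
proof -
  have k: "key \<gamma> i \<in> keys" using assms unfolding keys_def by blast
  have "i \<in> eqc (rel \<gamma>) i" using sock_Pos[OF assms] by (simp add: eqc_def)
  then show ?thesis using that inv_base[OF unit_of(1)[OF k]] by (simp add: key_def)
qed

lemma el_home:
  assumes "live u e" "(\<gamma>, m) \<in> active u" "g permutes words" "i < ar \<gamma>"
  obtains u' e' x where "el u e \<gamma> m g i = (u', e', x, lab \<gamma> i g)" "live u' e'"
    "x \<in> elems (unit_of u')" "state (unit_of u') x = ty \<gamma> i"
proof -
  have u: "u \<in> keys" using live_keys[OF assms(1)] by blast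
  show ?thesis
  proof (cases "m i")
    case (Some x)
    then show ?thesis using inv_fact(5)[OF unit_of(1)[OF u] active_facts[OF assms(2)] Some] assms(1)
      by (intro that[of u e x]) (simp_all add: el_def)
  next
    case None
    then have i: "i \<in> sock \<gamma>" using sock_iff[OF u assms(2,4)] by simp
    have ok: "okft \<gamma>" using active_okft[OF u assms(2)] .
    have k: "key \<gamma> i \<in> keys" using ok i unfolding keys_def by blast
    obtain m' where "(\<gamma>, m') \<in> facts (unit_of (key \<gamma> i))" "m' i = Some i" using key_root[OF ok i] by blast
    from inv_fact(5)[OF unit_of(1)[OF k] this] show ?thesis
      using None live_share[OF assms(1,2) i] by (intro that) (auto simp: el_def)
  qed
qed

lemma glued_typed:
  assumes "glued_at R xs u e \<gamma> m g"
  shows "okft \<gamma> \<and> rel \<gamma> = R \<and> g permutes words \<and> length xs = ar \<gamma> \<and>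
    (\<forall>i < ar \<gamma>. node_type (xs ! i) = (ty \<gamma> i, lab \<gamma> i g))"
proof -
  have a: "live u e" "(\<gamma>, m) \<in> active u" "g permutes words" "R = rel \<gamma>" "xs = map (el u e \<gamma> m g) [0..<ar \<gamma>]"
    using assms by (simp_all add: glued_at_def)
  have "node_type (xs ! i) = (ty \<gamma> i, lab \<gamma> i g)" if i: "i < ar \<gamma>" for i
  proof (rule el_home[OF a(1-3) i])
    fix u' e' x
    assume "el u e \<gamma> m g i = (u', e', x, lab \<gamma> i g)" "state (unit_of u') x = ty \<gamma> i"
    then show ?thesis using a(5) i by (simp add: node_type_def)
  qed
  moreover have "okft \<gamma>" using active_okft[OF _ a(2)] live_keys[OF a(1)] by blast
  ultimately show ?thesis using a by simp
qed

lemma glued_instance: "is_instance \<sigma> glued"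
  unfolding is_instance_def glued_def using glued_typed okft_rel by fastforce

lemma el_proj:
  assumes "live u e" "(\<gamma>, m) \<in> active u" "g permutes words" "i < ar \<gamma>"
  shows "el u e \<gamma> m g i \<in> proj glued (rel \<gamma>, i)"
proof -
  have "(rel \<gamma>, map (el u e \<gamma> m g) [0..<ar \<gamma>]) \<in> glued"
    unfolding glued_def glued_at_def using assms(1-3) by blast
  from projI[OF this, of i] show ?thesis using assms(4) by simp
qed

lemma key_eqv: "eqv (rel \<gamma>) i j \<Longrightarrow> key \<gamma> i = key \<gamma> j"
  by (simp add: key_def eqc_eq)

section \<open>Dependencies in the glued instance\<close>

lemma glued_uid:
  assumes PQ: "uid P Q"
  shows "proj glued P \<subseteq> proj glued Q"
proof
  obtain R p S q where P: "P = (R, p)" and Q: "Q = (S, q)" by (cases P, cases Q) blast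
  fix X assume "X \<in> proj glued P"
  then obtain xs where xs: "(R, xs) \<in> glued" "xs ! p = X" unfolding P by (rule projE)
  then obtain u e \<gamma> m g where a: "live u e" "(\<gamma>, m) \<in> active u" "g permutes words" "R = rel \<gamma>"
    "xs = map (el u e \<gamma> m g) [0..<ar \<gamma>]" unfolding glued_def glued_at_def by blast
  have p: "p < ar \<gamma>" and q: "q < arity \<sigma> S" using uid_Pos[OF PQ] P Q a(4) by (simp_all add: Pos_iff)
  have X: "X = el u e \<gamma> m g p" using xs(2) a(5) p by simp
  have ok: "okft \<gamma>" using active_okft[OF _ a(2)] live_keys[OF a(1)] by blast
  show "X \<in> proj glued Q"
  proof (rule el_home[OF a(1-3) p])
    fix u' e' x
    assume el: "el u e \<gamma> m g p = (u', e', x, lab \<gamma> p g)" and live: "live u' e'"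
      and x: "x \<in> elems (unit_of u')" "state (unit_of u') x = ty \<gamma> p"
    let ?h = "lab \<gamma> p g"
    have h: "?h permutes words" using lab_permutes[OF a(3)] .
    have u': "u' \<in> keys" using live_keys[OF live] by blast
    have "Q \<in> up (ty \<gamma> p)" using okft_ty(2)[OF ok p] PQ P a(4) up_closed by simp
    then have "x \<in> need (unit_of u') Q" using x by (simp add: need_def)
    then have "x \<in> occ (unit_of u') Q" using unit_of(2)[OF u'] by blast
    then obtain \<gamma>' m' where f: "(\<gamma>', m') \<in> facts (unit_of u')" "rel \<gamma>' = S" "m' q = Some x"
      unfolding occ_def Q by auto
    show ?thesis
    proof (cases "(\<gamma>', m') \<in> active u'")
      case True
      obtain g' where g': "g' permutes words" "lab \<gamma>' q g' = ?h" using lab_surj[OF h] by blast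
      then have "el u' e' \<gamma>' m' g' q = X" using f(3) el X by (simp add: el_def)
      then show ?thesis using el_proj[OF live True g'(1)] q f(2) Q by metis
    next
      case False
      \<comment> \<open>The fact found is a stand-in; \<open>live\<close> supplies a real fact that
        refers to this copy, and \<open>x\<close> is what fills its position
        \<open>q\<close>.\<close>
      then have root: "u' \<noteq> None" "(\<gamma>', m') \<in> base u'" using f(1) by (auto simp: active_def split: if_splits)
      from live root(1) obtain u1 e1 \<gamma>1 m1 i where l: "live u1 e1" "(\<gamma>1, m1) \<in> active u1" "i \<in> sock \<gamma>1"
        "u' = key \<gamma>1 i" "e' = share (u1, e1, \<gamma>1, m1) i"
        by (cases rule: live.cases) auto
      have \<gamma>1: "\<gamma>' = \<gamma>1" "x = q" "eqv (rel \<gamma>1) i q"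
        using root(2) f(3) l(4) by (auto simp: key_def eqc_def split: if_splits)
      have q1: "q < ar \<gamma>1" "q \<in> sock \<gamma>1" using q f(2) \<gamma>1 sock_eqv[OF l(3)] by simp_all
      obtain g' where g': "g' permutes words" "lab \<gamma>1 q g' = ?h" using lab_surj[OF h] by blast
      have "m1 q = None" using sock_iff[OF _ l(2) q1(1)] q1(2) live_keys[OF l(1)] by blast
      then have "el u1 e1 \<gamma>1 m1 g' q = X"
        using el X l(4,5) \<gamma>1 g'(2) key_eqv[OF \<gamma>1(3)] by (simp add: el_def share_def)
      then show ?thesis using el_proj[OF l(1,2) g'(1) q1(1)] f(2) \<gamma>1(1) Q by metis
    qed
  qed
qed

text \<open>The common element would be element \<open>l\<close> of the unit
  \<open>key \<gamma>' l\<close>, where the base fact has it at position \<open>l\<close>. By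
  linearity the first fact is this base fact, which is not active.\<close>

lemma el_clash:
  assumes "live u e" "(\<gamma>, m) \<in> active u" "live u' e'" "(\<gamma>', m') \<in> active u'" "rel \<gamma> = rel \<gamma>'"
    and l: "l < ar \<gamma>" "m l = Some x" "m' l = None" and eq: "el u e \<gamma> m g l = el u' e' \<gamma>' m' g' l"
  shows False
proof -
  have u: "u = key \<gamma>' l" "x = l" using eq l by (simp_all add: el_def)
  have k: "u \<in> keys" "u' \<in> keys" using live_keys assms by blast+
  have s: "l \<in> sock \<gamma>'" using sock_iff[OF k(2) assms(4)] l assms(5) by simp
  obtain m0 where m0: "base (key \<gamma>' l) = {(\<gamma>', m0)}" "(\<gamma>', m0) \<in> facts (unit_of u)" "m0 l = Some l"
    using key_root[OF active_okft[OF k(2) assms(4)] s] u(1) by blast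
  have "(\<gamma>, m) = (\<gamma>', m0) \<or> (\<exists>R xs ys. \<gamma> = Init R xs \<and> \<gamma>' = Init R ys)"
    using inv_linear[OF unit_of(1)[OF k(1)] active_facts[OF assms(2)] m0(2) assms(5) _ m0(3)] l u by simp
  then have "(\<gamma>, m) = (\<gamma>', m0)" using sock_Cr[OF s] by auto
  then show False using assms(2) m0(1) u(1) by (simp add: active_def key_def)
qed

lemma el_eq_cases:
  assumes a: "live u e" "(\<gamma>, m) \<in> active u" "live u' e'" "(\<gamma>', m') \<in> active u'" "rel \<gamma> = rel \<gamma>'"
    and l: "l < ar \<gamma>" and eq: "el u e \<gamma> m g l = el u' e' \<gamma>' m' g' l"
  obtains "(u, e, \<gamma>, m) = (u', e', \<gamma>', m')" "g = g'"
  | R xs ys where "u = u'" "e = e'" "\<gamma> = Init R xs" "\<gamma>' = Init R ys" "m l = m' l" "g = g'"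
  | "\<gamma> = \<gamma>'" "g = g'" "l \<in> sock \<gamma>" "share (u, e, \<gamma>, m) l = share (u', e', \<gamma>', m') l"
proof -
  have k: "u \<in> keys" "u' \<in> keys" using live_keys a by blast+
  consider x y where "m l = Some x" "m' l = Some y" | "m l = None" "m' l = None"
    using el_clash[OF a l _ _ eq] el_clash[OF a(3,4,1,2) a(5)[symmetric] _ _ _ eq[symmetric]] l a(5)
    by (cases "m l"; cases "m' l") auto
  then show ?thesis
  proof cases
    case 1
    then have e: "u = u'" "e = e'" "x = y" "lab \<gamma> l g = lab \<gamma>' l g'" using eq by (simp_all add: el_def)
    then have "(\<gamma>', m') \<in> active u" using a(4) by simp
    from inv_linear[OF unit_of(1)[OF k(1)] active_facts[OF a(2)] active_facts[OF this] a(5), of l x] 1 e(3)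
    have "(\<gamma>, m) = (\<gamma>', m') \<or> (\<exists>R xs ys. \<gamma> = Init R xs \<and> \<gamma>' = Init R ys)" by simp
    then show ?thesis
    proof
      assume "(\<gamma>, m) = (\<gamma>', m')"
      then show ?thesis using that(1) e lab_inj[of \<gamma> l g g'] by simp
    next
      assume "\<exists>R xs ys. \<gamma> = Init R xs \<and> \<gamma>' = Init R ys"
      then show ?thesis using that(2) e 1 by auto
    qed
  next
    case 2
    then have e: "key \<gamma> l = key \<gamma>' l" "share (u, e, \<gamma>, m) l = share (u', e', \<gamma>', m') l" "lab \<gamma> l g = lab \<gamma>' l g'"
      using eq by (simp_all add: el_def)
    have "\<gamma> = \<gamma>'" using e(1) by (simp add: key_def)
    moreover have "l \<in> sock \<gamma>" using sock_iff[OF k(1) a(2) l] 2 by simp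
    ultimately show ?thesis using that(3) e lab_inj[of \<gamma> l g g'] by simp
  qed
qed

lemma share_eq:
  assumes "share (u, e, \<gamma>, m) l = share (u', e', \<gamma>, m') l" "a \<in> seen (key \<gamma> l)"
  shows "vec (u, e, \<gamma>, m) a = vec (u', e', \<gamma>, m') a"
  using fun_cong[OF assms(1), of a] assms(2) by (simp add: share_def)

lemma seen_key: "(rel \<gamma>, l) \<in> Pos \<sigma> \<Longrightarrow> a \<in> seen (key \<gamma> l) \<longleftrightarrow> a < dimn \<and> \<not> (a \<in> sock \<gamma> \<and> ufd (rel \<gamma>) a l)"
proof -
  assume "(rel \<gamma>, l) \<in> Pos \<sigma>"
  then have "(\<exists>i \<in> eqc (rel \<gamma>) l. ufd (rel \<gamma>) a i) \<longleftrightarrow> ufd (rel \<gamma>) a l"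
    using ufd_trans[of "rel \<gamma>" a _ l] eqv_refl unfolding eqc_def eqv_def by blast
  then show ?thesis unfolding key_def seen.simps by blast
qed

lemma glued_fd:
  assumes fd: "FD R L r \<in> \<Sigma>"
  shows "sat_dep glued (FD R L r)"
  unfolding sat_dep.simps
proof (intro allI impI)
  fix xs ys assume xs: "(R, xs) \<in> glued" and ys: "(R, ys) \<in> glued" and eqL: "\<forall>l \<in> L. xs ! l = ys ! l"
  note fdD = FD_D[OF fd]
  obtain u e \<gamma> m g where a: "live u e" "(\<gamma>, m) \<in> active u" "R = rel \<gamma>"
    "xs = map (el u e \<gamma> m g) [0..<ar \<gamma>]" using xs unfolding glued_def glued_at_def by blast
  obtain u' e' \<gamma>' m' g' where a': "live u' e'" "(\<gamma>', m') \<in> active u'" "R = rel \<gamma>'"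
    "ys = map (el u' e' \<gamma>' m' g') [0..<ar \<gamma>']" using ys unfolding glued_def glued_at_def by blast
  have rel: "rel \<gamma> = rel \<gamma>'" using a a' by simp
  have k: "u \<in> keys" "u' \<in> keys" using live_keys a a' by blast+
  have lt: "l < ar \<gamma>" if "l \<in> L" for l using fdD that a(3) by (simp add: Pos_iff)
  have r: "r < ar \<gamma>" using fdD a(3) by (simp add: Pos_iff)
  have eq: "el u e \<gamma> m g l = el u' e' \<gamma>' m' g' l" if "l \<in> L" for l
    using eqL lt[OF that] that a(4) a'(4) rel by auto
  note cases = el_eq_cases[OF a(1,2) a'(1,2) rel lt eq]
  have "el u e \<gamma> m g r = el u' e' \<gamma>' m' g' r"
  proof (cases "(u, e, \<gamma>, m) = (u', e', \<gamma>', m') \<and> g = g'")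
    case False
    obtain l0 where l0: "l0 \<in> L" using fdD by blast
    from cases[OF l0 l0] consider
        S us vs where "u = u'" "e = e'" "\<gamma> = Init S us" "\<gamma>' = Init S vs" "g = g'"
      | "\<gamma> = \<gamma>'" "g = g'" "l0 \<in> sock \<gamma>" using False by metis
    then show ?thesis
    proof cases
      case 1
      have I: "(S, us) \<in> I\<^sub>0" "(S, vs) \<in> I\<^sub>0" using active_okft[OF k(1) a(2)] active_okft[OF k(2) a'(2)] 1 by simp_all
      have m: "m = initm us" "m' = initm vs"
        using inv_fact(4)[OF unit_of(1)[OF k(1)] active_facts[OF a(2)] 1(3)]
          inv_fact(4)[OF unit_of(1)[OF k(2)] active_facts[OF a'(2)] 1(4)] .
      have SR: "S = R" using a(3) 1(3) by simp
      have us: "us ! l = vs ! l" if l: "l \<in> L" for l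
      proof -
        have lS: "l < arity \<sigma> S" using lt[OF l] 1(3) by simp
        have "\<iota> (us ! l) = \<iota> (vs ! l)"
          using eq[OF l] m lS I\<^sub>0_length[OF I(1)] I\<^sub>0_length[OF I(2)] by (simp add: el_def initm_def)
        then show ?thesis using \<iota>_eq[OF I\<^sub>0_adom[OF I(1) lS] I\<^sub>0_adom[OF I(2) lS]] by simp
      qed
      have "sat_dep I\<^sub>0 (FD S L r)" using sat_I\<^sub>0 fd SR by blast
      then have "us ! r = vs ! r" using I us unfolding sat_dep.simps by blast
      then have "m r = m' r" using m I\<^sub>0_length[OF I(1)] I\<^sub>0_length[OF I(2)] by (simp add: initm_def)
      moreover have "m r = Some (\<iota> (us ! r))"
        using m(1) r 1(3) I\<^sub>0_length[OF I(1)] by (simp add: initm_def)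
      ultimately have "m r = Some (\<iota> (us ! r))" "m' r = Some (\<iota> (us ! r))" by simp_all
      then show ?thesis using 1 by (simp add: el_def)
    next
      case 2
      obtain s R' p where Cr: "\<gamma> = Cr s R' p" using sock_Cr[OF 2(3)] by blast
      then have R': "R' = R" using a(3) by simp
      have L: "l \<in> sock \<gamma> \<and> share (u, e, \<gamma>, m) l = share (u', e', \<gamma>, m') l" if "l \<in> L" for l
        using cases[OF that that] False 2 Cr by (metis ftype.distinct(1))
      have P: "(R, l) \<in> Pos \<sigma>" if "l \<in> L" for l using fdD that by blast
      have vec_eq: "vec (u, e, \<gamma>, m) b = vec (u', e', \<gamma>, m') b"
        \<comment> \<open>An open position \<open>b\<close> that determined all of \<open>L\<close>
          would determine \<open>r\<close>. So a shared element at some position of \<open>L\<close>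
          remembers coordinate \<open>b\<close>.\<close>
        if b: "b < dimn" "\<not> (b \<in> sock \<gamma> \<and> ufd R b r)" for b
      proof -
        have "\<exists>l \<in> L. \<not> (b \<in> sock \<gamma> \<and> ufd R b l)"
          using b(2) l0 fd_trans[OF fd, of b] by blast
        then obtain l where l: "l \<in> L" "\<not> (b \<in> sock \<gamma> \<and> ufd R b l)" by blast
        then have "b \<in> seen (key \<gamma> l)" using seen_key[of \<gamma> l b] b(1) P[OF l(1)] a(3) by simp
        then show ?thesis using share_eq L[OF l(1)] by blast
      qed
      show ?thesis
      proof (cases "r \<in> sock \<gamma>")
        case True
        have "share (u, e, \<gamma>, m) r = share (u', e', \<gamma>, m') r"
        proof
          fix b
          have "(rel \<gamma>, r) \<in> Pos \<sigma>" using fdD a(3) by simp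
          then have "vec (u, e, \<gamma>, m) b = vec (u', e', \<gamma>, m') b" if "b \<in> seen (key \<gamma> r)"
            using vec_eq[of b] seen_key[of \<gamma> r b] a(3) that by blast
          then show "share (u, e, \<gamma>, m) r b = share (u', e', \<gamma>, m') r b"
            by (cases "b \<in> seen (key \<gamma> r)") (simp_all add: share_def)
        qed
        moreover have "m r = None" "m' r = None"
          using sock_iff[OF k(1) a(2) r] sock_iff[OF k(2) a'(2)] r rel True 2(1) by simp_all
        ultimately show ?thesis using 2 by (simp add: el_def)
      next
        case False
        \<comment> \<open>An open position that determined \<open>r\<close> would determine
          \<open>p\<close> and hence not be open. So \<open>vec_eq\<close> covers all coordinates,
          and injectivity of \<open>vec\<close> identifies the facts.\<close>
        then have rp: "ufd R r p" using r Cr R' by (simp add: sock_def)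
        have V: "vec (u, e, \<gamma>, m) \<in> vects {..<dimn}" "vec (u', e', \<gamma>, m') \<in> vects {..<dimn}"
          using vec(1)[OF active_index[OF a(1,2)]] vec(1)[OF active_index[OF a'(1,2)]] 2(1) by simp_all
        have "vec (u, e, \<gamma>, m) = vec (u', e', \<gamma>, m')"
        proof (rule PiE_ext)
          show "vec (u, e, \<gamma>, m) \<in> {..<dimn} \<rightarrow>\<^sub>E {..<base_size}" "vec (u', e', \<gamma>, m') \<in> {..<dimn} \<rightarrow>\<^sub>E {..<base_size}"
            using V by (simp_all add: vects_def)
          fix b assume "b \<in> {..<dimn}"
          moreover have "\<not> (b \<in> sock \<gamma> \<and> ufd R b r)"
            using ufd_trans[of R b r p] rp Cr R' by (auto simp: sock_def)
          ultimately show "vec (u, e, \<gamma>, m) b = vec (u', e', \<gamma>, m') b" using vec_eq by simp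
        qed
        then have "(u, e, \<gamma>, m) = (u', e', \<gamma>, m')"
          using active_index[OF a(1,2)] active_index[OF a'(1,2)] 2(1) by (intro inj_onD[OF vec(2)]) simp_all
        then show ?thesis using 2 by simp
      qed
    qed
  qed simp
  then show "xs ! r = ys ! r" using a(4) a'(4) r rel by simp
qed

text \<open>Among the copies of the initial instance, one for each permutation, the one with the
  identity is taken for \<open>I\<^sub>0\<close> itself.\<close>

lemma initial_glued:
  assumes "(R, xs) \<in> I\<^sub>0"
  shows "(R, map (\<lambda>a. (None, \<lambda>_. undefined, \<iota> a, id)) xs) \<in> glued"
proof -
  have "(Init R xs, initm xs) \<in> base None" using assms by force
  moreover have "base None \<subseteq> facts (unit_of None)" by (rule inv_base[OF unit_of(1)]) (simp add: keys_def)
  ultimately have "(Init R xs, initm xs) \<in> active None" by (auto simp: active_def)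
  moreover have "map (\<lambda>a. (None, \<lambda>_. undefined, \<iota> a, id)) xs =
      map (el None (\<lambda>_. undefined) (Init R xs) (initm xs) id) [0..<ar (Init R xs)]"
    using I\<^sub>0_length[OF assms] by (intro nth_equalityI) (simp_all add: el_def initm_def)
  ultimately have "glued_at R (map (\<lambda>a. (None, \<lambda>_. undefined, \<iota> a, id)) xs)
      None (\<lambda>_. undefined) (Init R xs) (initm xs) id"
    unfolding glued_at_def using live_None permutes_id by simp
  then show ?thesis unfolding glued_def by blast
qed

end

section \<open>Renaming into the given type of elements\<close>

text \<open>Nodes that represent initial elements get their own names back, and the infinite type
  provides fresh names for the others.\<close>

lemma extend_inj_inverse:
  fixes c :: "'a \<Rightarrow> 'b"
  assumes "infinite (UNIV :: 'a set)" "finite N" "finite A" "inj_on c A"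
  obtains f where "inj_on f N" "\<And>a. a \<in> A \<Longrightarrow> f (c a) = a"
proof -
  have "infinite (UNIV - A)" using assms(1,3) by simp
  then obtain B where B: "B \<subseteq> UNIV - A" "finite B" "card B = card (N - c ` A)"
    using infinite_arbitrarily_large by blast
  then obtain h where h: "bij_betw h (N - c ` A) B"
    using finite_same_card_bij[of "N - c ` A" B] assms(2) by auto
  define f where "f x = (if x \<in> c ` A then inv_into A c x else h x)" for x
  have "inj_on f N"
  proof (rule inj_onI)
    fix x y assume xy: "x \<in> N" "y \<in> N" "f x = f y"
    have hB: "h z \<notin> A" if "z \<in> N" "z \<notin> c ` A" for z
      using bij_betwE[OF h] that B(1) by blast
    have cA: "inv_into A c z \<in> A" if "z \<in> c ` A" for z using inv_into_into[OF that] .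
    consider "x \<in> c ` A" "y \<in> c ` A" | "x \<notin> c ` A" "y \<notin> c ` A" | "x \<in> c ` A" "y \<notin> c ` A" | "x \<notin> c ` A" "y \<in> c ` A"
      by blast
    then show "x = y"
    proof cases
      case 1
      then show ?thesis using xy(3) by (simp add: f_def inv_into_injective)
    next
      case 2
      then show ?thesis using xy bij_betw_imp_inj_on[OF h] by (simp add: f_def inj_on_eq_iff)
    next
      case 3
      then show ?thesis using xy hB[of y] cA[of x] by (simp add: f_def)
    next
      case 4
      then show ?thesis using xy hB[of x] cA[of y] by (simp add: f_def)
    qed
  qed
  moreover have "f (c a) = a" if "a \<in> A" for a using that assms(4) by (simp add: f_def)
  ultimately show ?thesis by (rule that)
qed

context pstruct_base
begin

lemma typed_model:
  assumes inf: "infinite (UNIV :: 'a set)"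
  shows "\<exists>I \<tau>. finite I \<and> superinstance \<sigma> I\<^sub>0 I \<and> satisfies I \<Sigma> \<and> typed I \<tau>"
proof -
  define c :: "'a \<Rightarrow> ('r, 'a) node" where "c a = (None, \<lambda>_. undefined, \<iota> a, id)" for a
  define N where "N = (\<Union>(R, xs) \<in> glued. set xs)"
  have N: "xs ! i \<in> N" if "(R, xs) \<in> glued" "i < arity \<sigma> R" for R xs i
    using that glued_instance unfolding N_def by (intro UN_I[of "(R, xs)"]) (auto simp: is_instance_def)
  have len: "length xs = arity \<sigma> R" if "(R, xs) \<in> glued" for R xs
    using that glued_instance by (auto simp: is_instance_def)
  have "finite N" unfolding N_def using finite_glued by auto
  moreover have "inj_on c adom" using \<iota>_eq by (simp add: inj_on_def c_def)
  ultimately obtain f where f: "inj_on f N" "\<And>a. a \<in> adom \<Longrightarrow> f (c a) = a"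
    using extend_inj_inverse[OF inf _ finite_adom] by blast
  define I where "I = (\<lambda>(R, xs). (R, map f xs)) ` glued"
  have I_E: "\<exists>xs. (R, xs) \<in> glued \<and> ys = map f xs" if "(R, ys) \<in> I" for R ys
    using that by (auto simp: I_def)
  have I_I: "(R, map f xs) \<in> I" if "(R, xs) \<in> glued" for R xs
    using that unfolding I_def by (rule rev_image_eqI) simp
  have "finite I" unfolding I_def using finite_glued by simp
  moreover have "superinstance \<sigma> I\<^sub>0 I" unfolding superinstance_def
  proof
    show "is_instance \<sigma> I" using glued_instance by (auto simp: is_instance_def I_def)
    show "I\<^sub>0 \<subseteq> I"
    proof
      fix z assume z: "z \<in> I\<^sub>0"
      obtain R xs where z': "z = (R, xs)" by (cases z)
      then have "(R, map c xs) \<in> glued" using initial_glued[of R xs] z by (simp add: c_def[abs_def])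
      then have "(R, map f (map c xs)) \<in> I" by (rule I_I)
      moreover have "map f (map c xs) = xs"
      proof (rule nth_equalityI)
        fix i assume "i < length (map f (map c xs))"
        then show "map f (map c xs) ! i = xs ! i"
          using f(2)[of "xs ! i"] I\<^sub>0_adom[of R xs i] I\<^sub>0_length[of R xs] z z' by simp
      qed simp
      ultimately show "z \<in> I" using z' by simp
    qed
  qed
  moreover have "satisfies I \<Sigma>" unfolding satisfies_def
  proof
    fix d assume d: "d \<in> \<Sigma>"
    show "sat_dep I d"
    proof (cases d)
      case (UID P Q)
      then have uid: "uid P Q" using d UID_D[of P Q] by (simp add: uid_def)
      obtain R p S q where P: "P = (R, p)" and Q: "Q = (S, q)" by (cases P, cases Q) blast
      have lt: "p < arity \<sigma> R" "q < arity \<sigma> S" using uid_Pos[OF uid] P Q by (simp_all add: Pos_iff)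
      have "proj I P \<subseteq> proj I Q"
      proof
        fix y assume "y \<in> proj I P"
        then obtain ys where "(R, ys) \<in> I" "ys ! p = y" unfolding P by (rule projE)
        then obtain xs where xs: "(R, xs) \<in> glued" "y = f (xs ! p)" using I_E lt len by fastforce
        have "xs ! p \<in> proj glued Q" using glued_uid[OF uid] projI[OF xs(1), of p] P by blast
        then obtain zs where zs: "(S, zs) \<in> glued" "zs ! q = xs ! p" unfolding Q by (rule projE)
        then have "map f zs ! q = y" using lt len xs by simp
        then show "y \<in> proj I Q" using projI[OF I_I[OF zs(1)], of q] Q by simp
      qed
      then show ?thesis unfolding UID sat_UID_iff .
    next
      case (FD R L r)
      then have fd: "FD R L r \<in> \<Sigma>" using d by simp
      note fdD = FD_D[OF fd]
      show ?thesis unfolding FD sat_dep.simps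
      proof (intro allI impI)
        fix xs' ys' assume a: "(R, xs') \<in> I" "(R, ys') \<in> I" "\<forall>l \<in> L. xs' ! l = ys' ! l"
        obtain xs where xs: "(R, xs) \<in> glued" "xs' = map f xs" using I_E[OF a(1)] by blast
        obtain ys where ys: "(R, ys) \<in> glued" "ys' = map f ys" using I_E[OF a(2)] by blast
        have "xs ! l = ys ! l" if "l \<in> L" for l
        proof -
          have l: "l < arity \<sigma> R" using fdD that by (simp add: Pos_iff)
          then have "f (xs ! l) = f (ys ! l)" using a(3) that xs ys len by auto
          then show ?thesis using N[OF xs(1) l] N[OF ys(1) l] f(1) by (simp add: inj_on_eq_iff)
        qed
        then have "xs ! r = ys ! r" using glued_fd[OF fd] xs(1) ys(1) unfolding sat_dep.simps by blast
        then show "xs' ! r = ys' ! r" using fdD xs ys len by (simp add: Pos_iff)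
      qed
    qed
  qed
  moreover have "typed I (\<lambda>y. node_type (inv_into N f y))" unfolding typed_def
  proof
    fix z assume "z \<in> I"
    then obtain R xs where z: "z = (R, map f xs)" and xs: "(R, xs) \<in> glued" by (auto simp: I_def)
    then obtain u e \<gamma> m g where "glued_at R xs u e \<gamma> m g" unfolding glued_def by blast
    note t = glued_typed[OF this]
    have "inv_into N f (map f xs ! i) = xs ! i" if "i < ar \<gamma>" for i
      using N[OF xs, of i] t that f(1) by auto
    then show "case z of (R, xs) \<Rightarrow> \<exists>\<gamma> g. okft \<gamma> \<and> rel \<gamma> = R \<and> g permutes words \<and> length xs = ar \<gamma> \<and>
     (\<forall>i < ar \<gamma>. node_type (inv_into N f (xs ! i)) = (ty \<gamma> i, lab \<gamma> i g))"
      unfolding z prod.case using t by (intro exI[of _ \<gamma>] exI[of _ g]) simp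
  qed
  ultimately show ?thesis by blast
qed

end

theorem mainTheorem3:
  fixes \<sigma> :: "'r schema"
    and \<Sigma>\<^sub>F\<^sub>D \<Sigma>\<^sub>U\<^sub>I\<^sub>D \<Sigma> :: "'r dependency set"
    and I\<^sub>0 :: "('r, 'a) fact set"
    and k :: nat
  assumes "infinite (UNIV :: 'a set)"
    and "wf_schema \<sigma>"
    and "\<Sigma>\<^sub>F\<^sub>D \<subseteq> FDs \<sigma>"
    and "\<Sigma>\<^sub>U\<^sub>I\<^sub>D \<subseteq> UIDs \<sigma>"
    and "\<Sigma> = \<Sigma>\<^sub>F\<^sub>D \<union> \<Sigma>\<^sub>U\<^sub>I\<^sub>D"
    and "closed_under_finite_implication TYPE('a) \<sigma> \<Sigma>"
    and "is_instance \<sigma> I\<^sub>0"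
    and "finite I\<^sub>0"
    and "satisfies I\<^sub>0 \<Sigma>\<^sub>F\<^sub>D"
  shows "\<exists>I :: ('r, 'a) fact set. finite I \<and> superinstance \<sigma> I\<^sub>0 I \<and> satisfies I \<Sigma> \<and>
           k_sound \<sigma> k \<Sigma> I\<^sub>0 I \<and> k_universal \<sigma> k \<Sigma> I\<^sub>0 I"
proof -
  \<comment> \<open>At most \<open>2 * (k * k)\<close> letters are used up; the successor leaves one
    event even at the farthest fact, which ties initial elements to their values.\<close>
  interpret fin_closed \<sigma> \<Sigma> I\<^sub>0 "Suc (2 * (k * k))"
  proof
    fix R L r assume "FD R L r \<in> \<Sigma>"
    then have "FD R L r \<in> \<Sigma>\<^sub>F\<^sub>D" using assms(4,5) by (auto simp: UIDs_def)
    then show "sat_dep I\<^sub>0 (FD R L r)" using assms(9) unfolding satisfies_def by blast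
  next
    show "wf_schema \<sigma>" "closed_under_finite_implication TYPE('a) \<sigma> \<Sigma>" "is_instance \<sigma> I\<^sub>0" "finite I\<^sub>0"
      by (fact assms)+
    show "\<Sigma> \<subseteq> UIDs \<sigma> \<union> FDs \<sigma>" using assms(3-5) by blast
  qed simp
  have "finite (\<Union>(R, xs) \<in> I\<^sub>0. set xs)" using assms(8) by auto
  then obtain \<iota> :: "'a \<Rightarrow> nat" where "inj_on \<iota> (\<Union>(R, xs) \<in> I\<^sub>0. set xs)"
    using finite_imp_inj_to_nat_seg[of "\<Union>(R, xs) \<in> I\<^sub>0. set xs"] by metis
  then interpret pstruct_base \<sigma> \<Sigma> I\<^sub>0 "Suc (2 * (k * k))" \<iota> by unfold_locales
  obtain I \<tau> where I: "finite I" "superinstance \<sigma> I\<^sub>0 I" "satisfies I \<Sigma>" "typed I \<tau>"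
    using typed_model[OF assms(1)] by blast
  have "k_sound \<sigma> k \<Sigma> I\<^sub>0 I"
    unfolding k_sound_def entails_unr_def cq_size_def
    using typed_sat_cq[OF I(4), of _ k] by (simp add: model_def)
  \<comment> \<open>\<open>I\<close> is itself one of the superinstances over which entailment
    quantifies.\<close>
  moreover from this have "k_universal \<sigma> k \<Sigma> I\<^sub>0 I"
    unfolding k_universal_def entails_unr_def using I by blast
  ultimately show ?thesis using I by blast
qed

end
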